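(* Let $X\subset V\cong\mathbb{C}^{N+1}$ be a rational variety. Let $Z\subset X$ be a rational subvariety. Then the conditional ED correspondence $\mathcal{E}_{X|Z}$ of $X$ given $Z$ is rational.
   Context: $V=\mathbb{C}^{N+1}$ carries the bilinear form $\langle x,y\rangle=\sum_i x_iy_i$. $X$ and $Z$ are affine varieties in $V$, reduced and irreducible. $X_{\rm sm}$ is the set of smooth points of $X$. For a smooth point $x$ of $X$, $T_xX\subset V$ is the linear tangent space and $N_xX=\{y\in V\mid\langle y,v\rangle=0\ \forall v\in T_xX\}$. The conditional ED correspondence of $X$ given $Z$ is the Zariski closure $\mathcal{E}_{X|Z}=\overline{\{(x,u)\in V\times V\mid x\in X_{\rm sm}\cap Z,\ u-x\in N_xX\}}$.
   Formalization: It is additionally assumed that Z meets the smooth locus of X; otherwise the conditional ED correspondence is empty and not a rational variety, e.g. X a cuspidal cubic and Z its cusp. *)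

theory Defs
  imports "HOL-Analysis.Analysis" "HOL-Library.Extended_Nat"
begin

section \<open>Polynomial functions\<close>

text \<open>
  Affine spaces over the complex numbers are handled uniformly through their coordinate functions,
  so that \<open>V = complex ^ 'n\<close>, \<open>V \<times> V\<close> and the affine spaces of varying dimension below all carry
  polynomial functions. As the field is infinite, polynomials are identified with the functions
  they induce.
\<close>

class affine_coords =
  fixes coords :: "('a \<Rightarrow> complex) set"

instantiation complex :: affine_coords
begin
definition coords_complex_def: "coords = {\<lambda>z :: complex. z}"
instance ..
end

instantiation vec :: (affine_coords, finite) affine_coords
begin
definition coords_vec_def: "coords = {\<lambda>x :: 'a ^ 'b. c (x $ i) |c i. c \<in> coords}"
instance ..
end

instantiation prod :: (affine_coords, affine_coords) affine_coords
begin
definition coords_prod_def: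
  "coords = {\<lambda>p :: 'a \<times> 'b. c (fst p) |c. c \<in> coords} \<union> {\<lambda>p. c (snd p) |c. c \<in> coords}"
instance ..
end

instantiation "fun" :: (type, affine_coords) affine_coords
begin
definition coords_fun_def: "coords = {\<lambda>x :: 'a \<Rightarrow> 'b. c (x i) |c i. c \<in> coords}"
instance ..
end

inductive_set polys :: "('a :: affine_coords \<Rightarrow> complex) set" where
  const: "(\<lambda>_. a) \<in> polys"
| coord: "c \<in> coords \<Longrightarrow> c \<in> polys"
| add: "p \<in> polys \<Longrightarrow> q \<in> polys \<Longrightarrow> (\<lambda>x. p x + q x) \<in> polys"
| mult: "p \<in> polys \<Longrightarrow> q \<in> polys \<Longrightarrow> (\<lambda>x. p x * q x) \<in> polys"


section \<open>The Zariski topology\<close>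

definition zeros :: "('a \<Rightarrow> complex) set \<Rightarrow> 'a set" where
  "zeros F = {x. \<forall>f\<in>F. f x = 0}"

definition zariski :: "'a :: affine_coords topology" where
  "zariski = topology (\<lambda>U. \<exists>F\<subseteq>polys. U = - zeros F)"

lemma istopology_zariski:
  "istopology (\<lambda>U :: 'a :: affine_coords set. \<exists>F\<subseteq>polys. U = - zeros F)"
  unfolding istopology_def
proof (intro conjI allI impI)
  fix S T :: "'a set"
  assume "\<exists>F\<subseteq>polys. S = - zeros F" and "\<exists>F\<subseteq>polys. T = - zeros F"
  then obtain F G where F: "F \<subseteq> polys" "S = - zeros F" and G: "G \<subseteq> polys" "T = - zeros G"
    by blast
  let ?H = "{\<lambda>x. f x * g x |f g. f \<in> F \<and> g \<in> G}"
  have "?H \<subseteq> polys"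
    using F(1) G(1) by (auto intro: polys.mult)
  moreover have "S \<inter> T = - zeros ?H"
  proof (rule set_eqI)
    fix x
    have "x \<in> - zeros ?H \<longleftrightarrow> (\<exists>f\<in>F. \<exists>g\<in>G. f x * g x \<noteq> 0)"
      by (fastforce simp: zeros_def)
    then show "x \<in> S \<inter> T \<longleftrightarrow> x \<in> - zeros ?H"
      unfolding F(2) G(2) by (auto simp: zeros_def)
  qed
  ultimately show "\<exists>F\<subseteq>polys. S \<inter> T = - zeros F" by blast
next
  fix K :: "'a set set"
  assume "\<forall>U\<in>K. \<exists>F\<subseteq>polys. U = - zeros F"
  then obtain F where F: "\<And>U. U \<in> K \<Longrightarrow> F U \<subseteq> polys \<and> U = - zeros (F U)"
    by metis
  have "(\<Union>U\<in>K. F U) \<subseteq> polys"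
    using F by blast
  moreover have "\<Union>K = - zeros (\<Union>U\<in>K. F U)"
    using F by (fastforce simp: zeros_def)
  ultimately show "\<exists>F\<subseteq>polys. \<Union>K = - zeros F" by blast
qed

lemma openin_zariski: "openin zariski U \<longleftrightarrow> (\<exists>F\<subseteq>polys. U = - zeros F)"
  unfolding zariski_def topology_inverse'[OF istopology_zariski] by (rule refl)

lemma topspace_zariski [simp]: "topspace zariski = UNIV"
proof -
  have "UNIV = - zeros {\<lambda>_. 1}" by (simp add: zeros_def)
  then have "openin zariski UNIV"
    unfolding openin_zariski by (intro exI[of _ "{\<lambda>_. 1}"]) (auto intro: polys.const)
  then show ?thesis
    using openin_subset by blast
qed

lemma closedin_zariski: "closedin zariski A \<longleftrightarrow> (\<exists>F\<subseteq>polys. A = zeros F)"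
  by (auto simp: closedin_def openin_zariski Compl_eq_Diff_UNIV[symmetric])

definition zariski_irreducible :: "'a :: affine_coords set \<Rightarrow> bool" where
  "zariski_irreducible S \<longleftrightarrow> S \<noteq> {} \<and>
     (\<forall>A B. closedin zariski A \<and> closedin zariski B \<and> S \<subseteq> A \<union> B \<longrightarrow> S \<subseteq> A \<or> S \<subseteq> B)"

definition affine_variety :: "'a :: affine_coords set \<Rightarrow> bool" where
  "affine_variety X \<longleftrightarrow> closedin zariski X \<and> zariski_irreducible X"

text \<open>The Krull dimension of the closed set \<open>X\<close>.\<close>

definition zariski_dim :: "'a :: affine_coords set \<Rightarrow> enat" where
  "zariski_dim X = Sup {enat d |d. \<exists>Y :: nat \<Rightarrow> 'a set.
     (\<forall>i\<le>d. affine_variety (Y i) \<and> Y i \<subseteq> X) \<and> (\<forall>i<d. Y i \<subset> Y (Suc i))}"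


section \<open>Rational varieties\<close>

definition regular_function :: "'a :: affine_coords set \<Rightarrow> ('a \<Rightarrow> complex) \<Rightarrow> bool" where
  "regular_function U h \<longleftrightarrow>
     (\<forall>x\<in>U. \<exists>W p q. openin zariski W \<and> x \<in> W \<and> p \<in> polys \<and> q \<in> polys \<and>
        (\<forall>y\<in>W \<inter> U. q y \<noteq> 0 \<and> h y = p y / q y))"

text \<open>
  A rational map from \<open>X\<close> to \<open>Y\<close> is represented by a regular map \<open>f\<close> on a nonempty open
  subset \<open>U\<close> of \<open>X\<close>.
\<close>

definition rational_map ::
    "'a :: affine_coords set \<Rightarrow> 'b :: affine_coords set \<Rightarrow> 'a set \<Rightarrow> ('a \<Rightarrow> 'b) \<Rightarrow> bool" where
  "rational_map X Y U f \<longleftrightarrow>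
     openin (subtopology zariski X) U \<and> U \<noteq> {} \<and> f ` U \<subseteq> Y \<and>
     (\<forall>c\<in>coords. regular_function U (\<lambda>x. c (f x)))"

text \<open>
  The nonemptiness conditions say that both composites are defined as rational maps.
\<close>

definition birational :: "'a :: affine_coords set \<Rightarrow> 'b :: affine_coords set \<Rightarrow> bool" where
  "birational X Y \<longleftrightarrow>
     (\<exists>U f V g. rational_map X Y U f \<and> rational_map Y X V g \<and>
        U \<inter> f -` V \<noteq> {} \<and> (\<forall>x\<in>U \<inter> f -` V. g (f x) = x) \<and>
        V \<inter> g -` U \<noteq> {} \<and> (\<forall>y\<in>V \<inter> g -` U. f (g y) = y))"

text \<open>
  Affine \<open>d\<close>-space, realised inside the sequences so that \<open>d\<close> can be quantified over.
\<close>

definition affine_nspace :: "nat \<Rightarrow> (nat \<Rightarrow> complex) set" where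
  "affine_nspace d = {t. \<forall>i\<ge>d. t i = 0}"

definition rational_variety :: "'a :: affine_coords set \<Rightarrow> bool" where
  "rational_variety X \<longleftrightarrow> affine_variety X \<and> (\<exists>d. birational X (affine_nspace d))"


section \<open>Conditional ED correspondence\<close>

definition vanishing_ideal :: "'a :: affine_coords set \<Rightarrow> ('a \<Rightarrow> complex) set" where
  "vanishing_ideal X = {f \<in> polys. \<forall>x\<in>X. f x = 0}"

text \<open>The vectors killed by the differentials at \<open>x\<close> of all polynomials vanishing on \<open>X\<close>.\<close>

definition tangent_space :: "(complex ^ 'n) set \<Rightarrow> complex ^ 'n \<Rightarrow> (complex ^ 'n) set" where
  "tangent_space X x = {v. \<forall>f\<in>vanishing_ideal X. deriv (\<lambda>t. f (x + t *s v)) 0 = 0}"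

definition smooth_points :: "(complex ^ 'n) set \<Rightarrow> (complex ^ 'n) set" where
  "smooth_points X = {x \<in> X. enat (vec.dim (tangent_space X x)) = zariski_dim X}"

text \<open>
  The bilinear form is \<^const>\<open>scalar_product\<close>, not the inner product of \<open>complex ^ 'n\<close>.
\<close>

definition ED_normal_space :: "(complex ^ 'n) set \<Rightarrow> complex ^ 'n \<Rightarrow> (complex ^ 'n) set" where
  "ED_normal_space X x = {y. \<forall>v\<in>tangent_space X x. scalar_product y v = 0}"

definition cond_ED_correspondence ::
    "(complex ^ 'n) set \<Rightarrow> (complex ^ 'n) set \<Rightarrow> ((complex ^ 'n) \<times> (complex ^ 'n)) set" where
  "cond_ED_correspondence X Z =
     zariski closure_of {(x, u). x \<in> smooth_points X \<inter> Z \<and> u - x \<in> ED_normal_space X x}"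

end

theory Submission
  imports Defs
begin

text \<open>
  Over a smooth point \<open>x\<close> the normal space is spanned by the gradients at \<open>x\<close> of polynomials vanishing
  on \<open>X\<close>, and on the open set where a fixed choice of such gradients stays independent they form a
  frame of the normal bundle. Hence an open part of the correspondence is \<open>W \<times> C\<^sup>r\<close> with \<open>W\<close> open
  in \<open>Z\<close>, the coordinates on \<open>C\<^sup>r\<close> being rational functions by Cramer's rule.

  This needs the smooth locus to be open, that is, \<open>dim X \<le> dim T\<^sub>x X\<close> for every \<open>x\<close> in \<open>X\<close>. For \<open>X\<close>
  birational to affine \<open>d\<close>-space both sides are compared with \<open>d\<close>. A chain of \<open>k + 1\<close> subvarieties
  yields \<open>k\<close> algebraically independent polynomials on \<open>X\<close>, so counting monomials in them against
  degrees in the \<open>d\<close> parameters gives \<open>k \<le> d\<close>. Differentiating the parametrization gives \<open>d\<close>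
  independent tangent vectors at general points, and \<open>dim T\<^sub>x X\<close> is upper semicontinuous in \<open>x\<close>.
\<close>

section \<open>Polynomial functions and the Zariski topology\<close>

lemma polys_sum: "(\<And>i. i \<in> A \<Longrightarrow> p i \<in> polys) \<Longrightarrow> (\<lambda>x. \<Sum>i\<in>A. p i x) \<in> polys"
  by (induction A rule: infinite_finite_induct) (auto intro: polys.const polys.add)

lemma polys_prod: "(\<And>i. i \<in> A \<Longrightarrow> p i \<in> polys) \<Longrightarrow> (\<lambda>x. \<Prod>i\<in>A. p i x) \<in> polys"
  by (induction A rule: infinite_finite_induct) (auto intro: polys.const polys.mult)

lemma polys_power: "p \<in> polys \<Longrightarrow> (\<lambda>x. p x ^ n) \<in> polys"
  by (induction n) (auto intro: polys.const polys.mult)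

lemma polys_diff: "p \<in> polys \<Longrightarrow> q \<in> polys \<Longrightarrow> (\<lambda>x. p x - q x) \<in> polys"
  using polys.add[OF _ polys.mult[OF polys.const[of "-1"]], of p q] by simp

lemma polys_compose:
  assumes "p \<in> polys" and "\<And>c. c \<in> coords \<Longrightarrow> (\<lambda>x. c (\<phi> x)) \<in> polys"
  shows "(\<lambda>x. p (\<phi> x)) \<in> polys"
  using assms(1) by induction (auto intro: polys.intros assms(2))

lemma coords_vec_iff: "c \<in> coords \<longleftrightarrow> (\<exists>i. c = (\<lambda>x :: complex ^ 'n. x $ i))"
  by (auto simp: coords_vec_def coords_complex_def)

lemma coords_seq_iff: "c \<in> coords \<longleftrightarrow> (\<exists>i. c = (\<lambda>t :: nat \<Rightarrow> complex. t i))"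
  by (auto simp: coords_fun_def coords_complex_def)

lemma coords_pair_iff:
  "c \<in> coords \<longleftrightarrow>
     (\<exists>i. c = (\<lambda>p :: (complex ^ 'n) \<times> (complex ^ 'm). fst p $ i)) \<or> (\<exists>i. c = (\<lambda>p. snd p $ i))"
  by (auto simp: coords_prod_def coords_vec_iff)

lemma polys_ident: "(\<lambda>z :: complex. z) \<in> polys"
  by (auto intro: polys.coord simp: coords_complex_def)

lemma polys_nth: "(\<lambda>x :: complex ^ 'n. x $ i) \<in> polys"
  by (auto intro!: polys.coord simp: coords_vec_iff)

lemma polys_apply: "(\<lambda>t :: nat \<Rightarrow> complex. t i) \<in> polys"
  by (auto intro!: polys.coord simp: coords_seq_iff)

lemma polys_fst: "p \<in> polys \<Longrightarrow> (\<lambda>x. p (fst x)) \<in> polys"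
  by (rule polys_compose) (auto intro!: polys.coord simp: coords_prod_def)

lemma polys_snd: "p \<in> polys \<Longrightarrow> (\<lambda>x. p (snd x)) \<in> polys"
  by (rule polys_compose) (auto intro!: polys.coord simp: coords_prod_def)

lemma polys_det:
  assumes "\<And>i j. (\<lambda>x. M x $ i $ j) \<in> polys"
  shows "(\<lambda>x. det (M x)) \<in> polys"
  unfolding det_def by (intro polys_sum polys.mult polys.const polys_prod assms)

lemma polys_complex_differentiable:
  fixes p :: "complex \<Rightarrow> complex"
  assumes "p \<in> polys"
  shows "p field_differentiable at z"
  using assms
proof induction
  case (coord c)
  then show ?case by (simp add: coords_complex_def)
qed (auto intro: derivative_intros)

section \<open>Basic open sets and irreducibility\<close>

lemma closedin_poly_zero: "p \<in> polys \<Longrightarrow> closedin zariski {x. p x = 0}"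
  unfolding closedin_zariski by (rule exI[of _ "{p}"]) (auto simp: zeros_def)

lemma openin_poly_nonzero: "p \<in> polys \<Longrightarrow> openin zariski {x. p x \<noteq> 0}"
  unfolding openin_zariski by (rule exI[of _ "{p}"]) (auto simp: zeros_def)

text \<open>A point outside \<open>zeros F\<close> is detected by a single member of
  \<open>F\<close>. Neighbourhoods are therefore given below by the nonvanishing of one polynomial,
  and their intersections by products.\<close>

lemma openin_zariskiD:
  assumes "openin zariski U" "x \<in> U"
  shows "\<exists>p\<in>polys. p x \<noteq> 0 \<and> (\<forall>y. p y \<noteq> 0 \<longrightarrow> y \<in> U)"
  using assms unfolding openin_zariski by (force simp: zeros_def)

lemma openin_subtopology_zariskiD:
  assumes "openin (subtopology zariski X) U" "x \<in> U"
  shows "\<exists>p\<in>polys. p x \<noteq> 0 \<and> (\<forall>y\<in>X. p y \<noteq> 0 \<longrightarrow> y \<in> U)"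
proof -
  from assms(1) obtain T where "openin zariski T" "U = T \<inter> X"
    by (auto simp: openin_subtopology)
  with openin_zariskiD[of T x] assms(2) show ?thesis
    by (metis Int_iff)
qed

text \<open>The zero set of \<open>p\<close> is closed. This is how equations found on a set are
  carried over to its closure.\<close>

lemma zariski_closure_of_vanish:
  assumes "p \<in> polys" "\<And>x. x \<in> S \<Longrightarrow> p x = 0" "x \<in> zariski closure_of S"
  shows "p x = 0"
proof -
  have "zariski closure_of S \<subseteq> {x. p x = 0}"
    using assms(1,2) by (intro closure_of_minimal closedin_poly_zero) auto
  with assms(3) show ?thesis by auto
qed

text \<open>Otherwise the zero sets of \<open>p\<close> and \<open>q\<close> would cover
  \<open>X\<close>. In this form irreducibility lets two generic conditions be met at one
  point.\<close>

lemma zariski_irreducibleD: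
  assumes "zariski_irreducible X" "p \<in> polys" "q \<in> polys"
    and "x \<in> X" "p x \<noteq> 0" "y \<in> X" "q y \<noteq> 0"
  shows "\<exists>z\<in>X. p z \<noteq> 0 \<and> q z \<noteq> 0"
proof (rule ccontr)
  assume "\<not> ?thesis"
  then have "X \<subseteq> {x. p x = 0} \<union> {x. q x = 0}" by auto
  then have "X \<subseteq> {x. p x = 0} \<or> X \<subseteq> {x. q x = 0}"
    using assms(1-3) closedin_poly_zero unfolding zariski_irreducible_def by blast
  with assms(4-) show False by auto
qed

text \<open>If neither closed set contains \<open>S\<close>, one equation of each fails somewhere on
  \<open>S\<close>; a point where both fail lies in neither set.\<close>

lemma zariski_irreducibleI:
  assumes "S \<noteq> {}"
    and "\<And>p q x y. p \<in> polys \<Longrightarrow> q \<in> polys \<Longrightarrow> x \<in> S \<Longrightarrow> p x \<noteq> 0 \<Longrightarrow> y \<in> S \<Longrightarrow> q y \<noteq> 0 \<Longrightarrow>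
            \<exists>z\<in>S. p z \<noteq> 0 \<and> q z \<noteq> 0"
  shows "zariski_irreducible S"
  unfolding zariski_irreducible_def
proof (intro conjI allI impI assms(1))
  fix A B assume AB: "closedin zariski A \<and> closedin zariski B \<and> S \<subseteq> A \<union> B"
  then obtain F G where F: "F \<subseteq> polys" "A = zeros F" and G: "G \<subseteq> polys" "B = zeros G"
    unfolding closedin_zariski by auto
  show "S \<subseteq> A \<or> S \<subseteq> B"
  proof (rule ccontr)
    assume "\<not> ?thesis"
    then obtain x y where "x \<in> S" "x \<notin> A" "y \<in> S" "y \<notin> B" by auto
    then obtain f g where fg: "f \<in> F" "f x \<noteq> 0" "g \<in> G" "g y \<noteq> 0"
      unfolding F G zeros_def by auto
    then obtain z where "z \<in> S" "f z \<noteq> 0" "g z \<noteq> 0"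
      using assms(2)[of f g x y] \<open>x \<in> S\<close> \<open>y \<in> S\<close> F G by blast
    with AB fg show False
      unfolding F G zeros_def by auto
  qed
qed

lemma zariski_irreducible_closure_of:
  assumes "zariski_irreducible S"
  shows "zariski_irreducible (zariski closure_of S)"
proof (rule zariski_irreducibleI)
  have sub: "S \<subseteq> zariski closure_of S"
    by (rule closure_of_subset) simp
  then show "zariski closure_of S \<noteq> {}"
    using assms by (auto simp: zariski_irreducible_def)
  fix p q :: "'a \<Rightarrow> complex" and x y
  assume *: "p \<in> polys" "q \<in> polys" "x \<in> zariski closure_of S" "p x \<noteq> 0"
    "y \<in> zariski closure_of S" "q y \<noteq> 0"
  then have "\<exists>x\<in>S. p x \<noteq> 0" "\<exists>y\<in>S. q y \<noteq> 0"
    using zariski_closure_of_vanish by metis+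
  then show "\<exists>z\<in>zariski closure_of S. p z \<noteq> 0 \<and> q z \<noteq> 0"
    using zariski_irreducibleD[OF assms *(1,2)] sub by blast
qed


section \<open>Regular functions\<close>

text \<open>Multiplying numerator and denominator by a polynomial \<open>r\<close> whose
  nonvanishing set lies in \<open>W\<close> absorbs the neighbourhood \<open>W\<close> into the
  condition that the denominator is nonzero.\<close>

lemma regular_function_iff:
  "regular_function U h \<longleftrightarrow>
     (\<forall>x\<in>U. \<exists>p\<in>polys. \<exists>q\<in>polys. q x \<noteq> 0 \<and> (\<forall>y\<in>U. q y \<noteq> 0 \<longrightarrow> h y = p y / q y))"
  (is "_ \<longleftrightarrow> ?R")
proof
  assume reg: "regular_function U h"
  show ?R
  proof
    fix x assume "x \<in> U"
    then obtain W p q where W: "openin zariski W" "x \<in> W" "p \<in> polys" "q \<in> polys"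
      "\<forall>y\<in>W \<inter> U. q y \<noteq> 0 \<and> h y = p y / q y"
      using reg unfolding regular_function_def by meson
    obtain r where r: "r \<in> polys" "r x \<noteq> 0" "\<And>y. r y \<noteq> 0 \<Longrightarrow> y \<in> W"
      using openin_zariskiD[OF W(1,2)] by auto
    show "\<exists>p\<in>polys. \<exists>q\<in>polys. q x \<noteq> 0 \<and> (\<forall>y\<in>U. q y \<noteq> 0 \<longrightarrow> h y = p y / q y)"
      using W r \<open>x \<in> U\<close>
      by (intro bexI[of _ "\<lambda>y. p y * r y"] bexI[of _ "\<lambda>y. q y * r y"] polys.mult W r) auto
  qed
next
  assume R: ?R
  show "regular_function U h"
    unfolding regular_function_def
  proof
    fix x assume "x \<in> U"
    then obtain p q where "p \<in> polys" "q \<in> polys" "q x \<noteq> 0"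
      "\<forall>y\<in>U. q y \<noteq> 0 \<longrightarrow> h y = p y / q y"
      using R by blast
    then show "\<exists>W p q. openin zariski W \<and> x \<in> W \<and> p \<in> polys \<and> q \<in> polys \<and>
        (\<forall>y\<in>W \<inter> U. q y \<noteq> 0 \<and> h y = p y / q y)"
      by (intro exI[of _ "{y. q y \<noteq> 0}"] exI[of _ p] exI[of _ q])
        (auto intro: openin_poly_nonzero)
  qed
qed

lemma regular_functionE:
  assumes "regular_function U h" "x \<in> U"
  obtains p q where "p \<in> polys" "q \<in> polys" "q x \<noteq> 0"
    "\<And>y. y \<in> U \<Longrightarrow> q y \<noteq> 0 \<Longrightarrow> h y = p y / q y"
  using assms unfolding regular_function_iff by blast

lemma regular_function_divide:
  assumes "p \<in> polys" "q \<in> polys" "\<And>x. x \<in> U \<Longrightarrow> q x \<noteq> 0"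
  shows "regular_function U (\<lambda>x. p x / q x)"
  using assms unfolding regular_function_iff by blast

lemma regular_function_poly: "p \<in> polys \<Longrightarrow> regular_function U p"
  using regular_function_divide[of p "\<lambda>_. 1"] by (simp add: polys.const)

lemma regular_function_add:
  assumes "regular_function U h" "regular_function U k"
  shows "regular_function U (\<lambda>x. h x + k x)"
  unfolding regular_function_iff
proof
  fix x assume x: "x \<in> U"
  obtain p q where pq: "p \<in> polys" "q \<in> polys" "q x \<noteq> 0"
    "\<And>y. y \<in> U \<Longrightarrow> q y \<noteq> 0 \<Longrightarrow> h y = p y / q y"
    using regular_functionE[OF assms(1) x] by metis
  obtain p' q' where pq': "p' \<in> polys" "q' \<in> polys" "q' x \<noteq> 0"
    "\<And>y. y \<in> U \<Longrightarrow> q' y \<noteq> 0 \<Longrightarrow> k y = p' y / q' y"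
    using regular_functionE[OF assms(2) x] by metis
  show "\<exists>p\<in>polys. \<exists>q\<in>polys. q x \<noteq> 0 \<and> (\<forall>y\<in>U. q y \<noteq> 0 \<longrightarrow> h y + k y = p y / q y)"
    using pq(3,4) pq'(3,4)
    by (intro bexI[of _ "\<lambda>y. p y * q' y + p' y * q y"] bexI[of _ "\<lambda>y. q y * q' y"]
        polys.add polys.mult pq(1,2) pq'(1,2)) (auto simp: add_frac_eq)
qed

lemma regular_function_mult:
  assumes "regular_function U h" "regular_function U k"
  shows "regular_function U (\<lambda>x. h x * k x)"
  unfolding regular_function_iff
proof
  fix x assume x: "x \<in> U"
  obtain p q where pq: "p \<in> polys" "q \<in> polys" "q x \<noteq> 0"
    "\<And>y. y \<in> U \<Longrightarrow> q y \<noteq> 0 \<Longrightarrow> h y = p y / q y"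
    using regular_functionE[OF assms(1) x] by metis
  obtain p' q' where pq': "p' \<in> polys" "q' \<in> polys" "q' x \<noteq> 0"
    "\<And>y. y \<in> U \<Longrightarrow> q' y \<noteq> 0 \<Longrightarrow> k y = p' y / q' y"
    using regular_functionE[OF assms(2) x] by metis
  show "\<exists>p\<in>polys. \<exists>q\<in>polys. q x \<noteq> 0 \<and> (\<forall>y\<in>U. q y \<noteq> 0 \<longrightarrow> h y * k y = p y / q y)"
    using pq(3,4) pq'(3,4)
    by (intro bexI[of _ "\<lambda>y. p y * p' y"] bexI[of _ "\<lambda>y. q y * q' y"]
        polys.mult pq(1,2) pq'(1,2)) auto
qed

lemma regular_function_sum:
  "(\<And>i. i \<in> A \<Longrightarrow> regular_function U (h i)) \<Longrightarrow> regular_function U (\<lambda>x. \<Sum>i\<in>A. h i x)"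
  by (induction A rule: infinite_finite_induct)
    (auto intro: regular_function_add regular_function_poly polys.const)

lemma regular_function_compose_poly:
  assumes "regular_function U h" "\<And>x. x \<in> U' \<Longrightarrow> \<phi> x \<in> U"
    and "\<And>c. c \<in> coords \<Longrightarrow> (\<lambda>x. c (\<phi> x)) \<in> polys"
  shows "regular_function U' (\<lambda>x. h (\<phi> x))"
  unfolding regular_function_iff
proof
  fix x assume "x \<in> U'"
  then obtain p q where pq: "p \<in> polys" "q \<in> polys" "q (\<phi> x) \<noteq> 0"
    "\<And>y. y \<in> U \<Longrightarrow> q y \<noteq> 0 \<Longrightarrow> h y = p y / q y"
    using regular_functionE[OF assms(1,2)] by metis
  moreover have "(\<lambda>y. p (\<phi> y)) \<in> polys" "(\<lambda>y. q (\<phi> y)) \<in> polys"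
    using pq(1,2) assms(3) by (auto intro: polys_compose[where \<phi> = \<phi>])
  ultimately show "\<exists>p\<in>polys. \<exists>q\<in>polys. q x \<noteq> 0 \<and> (\<forall>y\<in>U'. q y \<noteq> 0 \<longrightarrow> h (\<phi> y) = p y / q y)"
    using assms(2) by (metis (no_types, lifting))
qed

lemma regular_function_polys_compose:
  assumes "p \<in> polys" and "\<And>c. c \<in> coords \<Longrightarrow> regular_function U (\<lambda>x. c (\<phi> x))"
  shows "regular_function U (\<lambda>x. p (\<phi> x))"
  using assms(1)
  by induction
    (auto intro: regular_function_add regular_function_mult regular_function_poly polys.const assms(2))

lemma regular_function_nonzero:
  assumes "regular_function U h" "x \<in> U" "h x \<noteq> 0"
  shows "\<exists>p\<in>polys. p x \<noteq> 0 \<and> (\<forall>y\<in>U. p y \<noteq> 0 \<longrightarrow> h y \<noteq> 0)"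
proof -
  obtain p q where "p \<in> polys" "q \<in> polys" "q x \<noteq> 0"
    "\<And>y. y \<in> U \<Longrightarrow> q y \<noteq> 0 \<Longrightarrow> h y = p y / q y"
    using regular_functionE[OF assms(1,2)] by metis
  then show ?thesis
    using assms(2,3) by (intro bexI[of _ "\<lambda>y. p y * q y"]) (auto intro: polys.mult)
qed

text \<open>Continuity with the domain built in. If \<open>q\<close> cuts out a neighbourhood of
  \<open>f x\<close> inside \<open>V\<close>, then \<open>q (f y)\<close> is regular in
  \<open>y\<close>, hence nonzero near \<open>x\<close>; a product of two polynomials takes care of
  \<open>U\<close> and \<open>V\<close> together.\<close>

lemma rational_map_preimage_open:
  assumes "rational_map X Y U f" "openin (subtopology zariski Y) V" "x \<in> U" "f x \<in> V"
  shows "\<exists>p\<in>polys. p x \<noteq> 0 \<and> (\<forall>y\<in>X. p y \<noteq> 0 \<longrightarrow> y \<in> U \<and> f y \<in> V)"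
proof -
  have U: "openin (subtopology zariski X) U" and fU: "f ` U \<subseteq> Y"
    and f: "\<And>c. c \<in> coords \<Longrightarrow> regular_function U (\<lambda>x. c (f x))"
    using assms(1) by (auto simp: rational_map_def)
  obtain p where p: "p \<in> polys" "p x \<noteq> 0" "\<And>y. y \<in> X \<Longrightarrow> p y \<noteq> 0 \<Longrightarrow> y \<in> U"
    using openin_subtopology_zariskiD[OF U assms(3)] by auto
  obtain q where q: "q \<in> polys" "q (f x) \<noteq> 0" "\<And>y. y \<in> Y \<Longrightarrow> q y \<noteq> 0 \<Longrightarrow> y \<in> V"
    using openin_subtopology_zariskiD[OF assms(2,4)] by auto
  have "regular_function U (\<lambda>y. q (f y))"
    using q(1) f by (rule regular_function_polys_compose)
  then obtain r where r: "r \<in> polys" "r x \<noteq> 0" "\<And>y. y \<in> U \<Longrightarrow> r y \<noteq> 0 \<Longrightarrow> q (f y) \<noteq> 0"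
    using regular_function_nonzero assms(3) q(2) by blast
  show ?thesis
  proof (intro bexI[of _ "\<lambda>y. p y * r y"] polys.mult p(1) r(1) conjI ballI impI)
    show "p x * r x \<noteq> 0" using p r by simp
    fix y assume "y \<in> X" "p y * r y \<noteq> 0"
    then have "y \<in> U" "q (f y) \<noteq> 0" using p r by auto
    then show "y \<in> U" "f y \<in> V" using q fU by auto
  qed
qed


section \<open>Annihilators for the bilinear form\<close>

text \<open>The form is bilinear, so over the complex numbers a subspace can meet its annihilator.
  Dimension count and biduality are therefore drawn from invertible matrices and not from an
  orthogonal decomposition.\<close>

definition annihilator :: "('a :: field ^ 'n) set \<Rightarrow> ('a ^ 'n) set" where
  "annihilator R = {v. \<forall>y\<in>R. scalar_product y v = 0}"

text \<open>The span of the rows indexed by \<open>B\<close>. The matrix is square so that, when its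
  determinant is nonzero, the other rows complete these to a basis and inverses and Cramer's rule
  are at hand.\<close>

definition row_combinations :: "'a :: field ^ 'n ^ 'n \<Rightarrow> 'n set \<Rightarrow> ('a ^ 'n) set" where
  "row_combinations A B = {c v* A |c. \<forall>i. i \<notin> B \<longrightarrow> c $ i = 0}"

lemma scalar_product_commute: "scalar_product v w = scalar_product w (v :: 'a :: field ^ 'n)"
  by (simp add: scalar_product_def mult.commute)

lemma scalar_product_axis:
  "scalar_product (axis i 1) v = v $ i" "scalar_product v (axis i 1) = (v :: 'a :: field ^ 'n) $ i"
  by (simp_all add: scalar_product_def axis_def if_distrib if_distribR cong: if_cong)

lemma scalar_product_vector_matrix_mult:
  "scalar_product (c v* A) v = scalar_product c (A *v (v :: 'a :: field ^ 'n))"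
  unfolding scalar_product_def vector_matrix_mult_def matrix_vector_mult_def
  by (simp add: sum_distrib_left sum_distrib_right mult_ac) (rule sum.swap)

lemma vector_matrix_mult_rows: "c v* A = (\<Sum>i\<in>UNIV. c $ i *s (A $ i :: 'a :: field ^ 'n))"
  by (simp add: vec_eq_iff vector_matrix_mult_def)

lemma linear_vector_matrix_mult:
  "Vector_Spaces.linear (*s) (*s) (\<lambda>c. c v* (A :: 'a :: field ^ 'n ^ 'm))"
  by unfold_locales (auto simp: vector_matrix_left_distrib scalar_vector_matrix_assoc)

lemma invertible_matrix_vector:
  fixes A :: "'a :: field ^ 'n ^ 'n"
  assumes "det A \<noteq> 0"
  obtains A' where "\<And>v. A *v (A' *v v) = v" "\<And>v. A' *v (A *v v) = v"
    "\<And>c. (c v* A) v* A' = c" "\<And>c. (c v* A') v* A = c"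
proof -
  obtain A' where "A ** A' = mat 1" "A' ** A = mat 1"
    using assms invertible_det_nz[of A] unfolding invertible_def by auto
  then show ?thesis
    by (intro that[of A']) (simp_all add: matrix_vector_mul_assoc vector_matrix_mul_assoc)
qed

lemma subspace_row_combinations:
  "vec.subspace (row_combinations (A :: 'a :: field ^ 'n ^ 'n) B)"
proof -
  have "row_combinations A B = (\<lambda>c. c v* A) ` {c. \<forall>i. i \<notin> B \<longrightarrow> c $ i = 0}"
    by (auto simp: row_combinations_def)
  moreover have "vec.subspace {c :: 'a ^ 'n. \<forall>i. i \<notin> B \<longrightarrow> c $ i = 0}"
    by (auto simp: vec.subspace_def)
  ultimately show ?thesis
    using vec.linear_subspace_image[OF linear_vector_matrix_mult] by simp
qed

text \<open>Moving \<open>A\<close> to the other side of the form turns orthogonality to the rows in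
  \<open>B\<close> into the vanishing of the coordinates of \<open>A *v v\<close> in
  \<open>B\<close>.\<close>

lemma annihilator_row_combinations:
  "annihilator (row_combinations A B) = {v :: 'a :: field ^ 'n. \<forall>i\<in>B. (A *v v) $ i = 0}"
proof -
  have "v \<in> annihilator (row_combinations A B) \<longleftrightarrow> (\<forall>i\<in>B. (A *v v) $ i = 0)" for v
  proof
    assume L: "v \<in> annihilator (row_combinations A B)"
    show "\<forall>i\<in>B. (A *v v) $ i = 0"
    proof
      fix i assume "i \<in> B"
      then have "axis i 1 v* A \<in> row_combinations A B"
        by (auto simp: row_combinations_def axis_def)
      with L have "scalar_product (axis i 1 v* A) v = 0"
        by (auto simp: annihilator_def)
      then show "(A *v v) $ i = 0"
        by (simp add: scalar_product_vector_matrix_mult scalar_product_axis)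
    qed
  next
    assume "\<forall>i\<in>B. (A *v v) $ i = 0"
    then have "scalar_product c (A *v v) = 0" if "\<forall>i. i \<notin> B \<longrightarrow> c $ i = 0" for c
      using that unfolding scalar_product_def by (intro sum.neutral) auto
    then show "v \<in> annihilator (row_combinations A B)"
      by (auto simp: annihilator_def row_combinations_def scalar_product_vector_matrix_mult)
  qed
  then show ?thesis by auto
qed

text \<open>The inverse matrix maps the coordinate subspace of vectors supported outside
  \<open>B\<close> isomorphically onto the annihilator.\<close>

lemma dim_annihilator_row_combinations:
  fixes A :: "'a :: field ^ 'n ^ 'n"
  assumes "det A \<noteq> 0"
  shows "vec.dim (annihilator (row_combinations A B)) = CARD('n) - card B"
proof -
  obtain A' where A': "\<And>v. A *v (A' *v v) = v" "\<And>v. A' *v (A *v v) = v"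
    using invertible_matrix_vector[OF assms] by metis
  have inj: "inj ((*v) A')" using A'(1) by (rule inj_on_inverseI)
  have "annihilator (row_combinations A B) = (*v) A' ` {w. \<forall>i. i \<notin> - B \<longrightarrow> w $ i = 0}"
  proof (intro set_eqI iffI)
    fix v assume "v \<in> annihilator (row_combinations A B)"
    then show "v \<in> (*v) A' ` {w. \<forall>i. i \<notin> - B \<longrightarrow> w $ i = 0}"
      unfolding annihilator_row_combinations using A'(2)[of v]
      by (intro image_eqI[of _ _ "A *v v"]) auto
  qed (auto simp: annihilator_row_combinations A')
  then have "vec.dim (annihilator (row_combinations A B)) =
      vec.dim {w :: 'a ^ 'n. \<forall>i. i \<notin> - B \<longrightarrow> w $ i = 0}"
    using vec.dim_image_eq[OF matrix_vector_mul_linear_gen inj_on_subset[OF inj subset_UNIV], of _]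
    by simp
  also have "\<dots> = card (- B)"
    by (rule dim_substandard_cart)
  also have "\<dots> = CARD('n) - card B"
    unfolding Compl_eq_Diff_UNIV by (rule card_Diff_subset) auto
  finally show ?thesis .
qed

text \<open>Every \<open>y\<close> is \<open>c v* A\<close> for some \<open>c\<close>. The vectors
  \<open>A' *v axis i 1\<close> with \<open>i\<close> outside \<open>B\<close> lie in the
  annihilator, and pairing \<open>y\<close> with them reads off \<open>c $ i\<close>.\<close>

lemma annihilator_annihilator_row_combinations:
  fixes A :: "'a :: field ^ 'n ^ 'n"
  assumes "det A \<noteq> 0"
  shows "annihilator (annihilator (row_combinations A B)) = row_combinations A B"
proof
  obtain A' where A': "\<And>v. A *v (A' *v v) = v" "\<And>c. (c v* A') v* A = c"
    using invertible_matrix_vector[OF assms] by metis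
  show "annihilator (annihilator (row_combinations A B)) \<subseteq> row_combinations A B"
  proof
    fix y assume y: "y \<in> annihilator (annihilator (row_combinations A B))"
    define c where "c = y v* A'"
    have yc: "y = c v* A" by (simp add: c_def A')
    have "c $ i = 0" if "i \<notin> B" for i
    proof -
      have "A' *v axis i 1 \<in> annihilator (row_combinations A B)"
        using that by (auto simp: annihilator_row_combinations A' axis_def)
      then have "scalar_product (A' *v axis i 1) y = 0"
        using y unfolding annihilator_def[of "annihilator _"] by blast
      then have "scalar_product y (A' *v axis i 1) = 0"
        by (simp only: scalar_product_commute)
      then show ?thesis
        by (simp add: yc scalar_product_vector_matrix_mult A' scalar_product_axis)
    qed
    then show "y \<in> row_combinations A B"
      unfolding row_combinations_def yc by auto
  qed
  show "row_combinations A B \<subseteq> annihilator (annihilator (row_combinations A B))"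
    by (auto simp: annihilator_def) (metis scalar_product_commute)
qed

text \<open>A basis of \<open>R\<close> is extended to a basis of the whole space. The latter has
  \<open>CARD('n)\<close> members, so it can be indexed by \<open>'n\<close> and used as the rows of
  a square matrix.\<close>

lemma subspace_eq_row_combinations:
  fixes R :: "('a :: field ^ 'n) set"
  assumes "vec.subspace R"
  obtains A :: "'a ^ 'n ^ 'n" and B where "det A \<noteq> 0" "R = row_combinations A B"
    "\<And>i. i \<in> B \<Longrightarrow> A $ i \<in> R"
proof -
  obtain S where S: "S \<subseteq> R" "vec.independent S" "R \<subseteq> vec.span S"
    using vec.basis_exists[of R] by metis
  define T where "T = vec.extend_basis S"
  have T: "S \<subseteq> T" "vec.independent T" "vec.span T = UNIV"
    using S(2) by (simp_all add: T_def vec.extend_basis_superset vec.independent_extend_basis)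
  have finT: "finite T" using T(2) vec.finiteI_independent by blast
  have "card T = CARD('n)"
    using vec.dim_span_eq_card_independent[OF T(2)] T(3) vec_dim_card by metis
  then obtain b :: "'n \<Rightarrow> 'a ^ 'n" where b: "bij_betw b UNIV T"
    using finT by (metis finite_same_card_bij finite_class.finite_UNIV)
  define A where "A = (\<chi> i. b i)"
  define B where "B = {i. b i \<in> S}"
  have detA: "det A \<noteq> 0"
  proof -
    have "rows A = T" using b by (auto simp: rows_def row_def A_def bij_betw_def vec_lambda_eta)
    then have "vec.span (rows A) = UNIV" using T by simp
    then have "invertible A"
      using matrix_left_invertible_span_rows_gen invertible_left_inverse by blast
    then show ?thesis by (simp add: invertible_det_nz)
  qed
  have rowR: "A $ i \<in> R" if "i \<in> B" for i
    using that S by (auto simp: A_def B_def)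
  have "row_combinations A B \<subseteq> R"
  proof
    fix y assume "y \<in> row_combinations A B"
    then obtain c where c: "y = c v* A" "\<forall>i. i \<notin> B \<longrightarrow> c $ i = 0"
      by (auto simp: row_combinations_def)
    show "y \<in> R" unfolding c(1) vector_matrix_mult_rows
    proof (rule vec.subspace_sum[OF assms])
      fix i
      show "c $ i *s A $ i \<in> R"
        using c(2) rowR vec.subspace_scale[OF assms] vec.subspace_0[OF assms] by (cases "i \<in> B") auto
    qed
  qed
  moreover have "S \<subseteq> row_combinations A B"
  proof
    fix s assume "s \<in> S"
    then obtain i where i: "b i = s" using b T by (auto simp: bij_betw_def)
    have "axis i 1 v* A = s"
      by (simp add: vec_eq_iff vector_matrix_mult_def axis_def if_distrib if_distribR A_def i
          cong: if_cong)
    moreover have "i \<in> B" using i \<open>s \<in> S\<close> by (simp add: B_def)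
    ultimately show "s \<in> row_combinations A B"
      unfolding row_combinations_def by (intro CollectI exI[of _ "axis i 1"]) (auto simp: axis_def)
  qed
  then have "R \<subseteq> row_combinations A B"
    using S(3) subspace_row_combinations vec.span_minimal by blast
  ultimately show ?thesis using that[OF detA _ rowR] by blast
qed

lemma annihilator_annihilator:
  "vec.subspace R \<Longrightarrow> annihilator (annihilator R) = (R :: ('a :: field ^ 'n) set)"
  using subspace_eq_row_combinations annihilator_annihilator_row_combinations by metis

lemma subspace_annihilator: "vec.subspace (annihilator (R :: ('a :: field ^ 'n) set))"
proof -
  have "scalar_product y (v + w) = scalar_product y v + scalar_product y w"
    "scalar_product y (c *s v) = c * scalar_product y v" "scalar_product y 0 = 0"
    for y v w :: "'a ^ 'n" and c
    by (simp_all add: scalar_product_def distrib_left sum.distrib sum_distrib_left mult_ac)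
  then show ?thesis
    by (simp add: vec.subspace_def annihilator_def)
qed

lemma annihilator_antimono: "R \<subseteq> R' \<Longrightarrow> annihilator R' \<subseteq> annihilator R"
  by (auto simp: annihilator_def)


section \<open>Conormal spaces\<close>

definition grad :: "(complex ^ 'n \<Rightarrow> complex) \<Rightarrow> complex ^ 'n \<Rightarrow> complex ^ 'n" where
  "grad f x = (\<chi> i. deriv (\<lambda>t. f (x + t *s axis i 1)) 0)"

text \<open>No span is taken: the vanishing ideal is closed under linear combinations, so the
  gradients already form a subspace.\<close>

definition conormal :: "(complex ^ 'n) set \<Rightarrow> complex ^ 'n \<Rightarrow> (complex ^ 'n) set" where
  "conormal X x = {grad f x |f. f \<in> vanishing_ideal X}"

text \<open>The sum and product rules build \<open>G\<close> by recursion over the polynomial;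
  testing on coordinate lines later identifies it with \<open>grad f\<close>. Arbitrary curves are
  allowed because parametrized curves in \<open>X\<close> will be differentiated.\<close>

lemma ex_poly_gradient:
  fixes f :: "complex ^ 'n \<Rightarrow> complex"
  assumes "f \<in> polys"
  shows "\<exists>G. (\<forall>i. (\<lambda>x. G x $ i) \<in> polys) \<and>
    (\<forall>\<gamma> w. (\<forall>i. ((\<lambda>z. \<gamma> z $ i) has_field_derivative w $ i) (at 0)) \<longrightarrow>
      ((\<lambda>z. f (\<gamma> z)) has_field_derivative scalar_product (G (\<gamma> 0)) w) (at 0))"
  using assms
proof induction
  case (const a)
  show ?case
    by (rule exI[of _ "\<lambda>_. 0"]) (auto simp: scalar_product_def intro: polys.const)
next
  case (coord c)
  then obtain i where "c = (\<lambda>x. x $ i)" by (auto simp: coords_vec_iff)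
  then show ?case
    by (intro exI[of _ "\<lambda>_. axis i 1"]) (auto simp: scalar_product_axis intro: polys.const)
next
  case (add p q)
  then obtain G H where G: "\<And>i. (\<lambda>x. G x $ i) \<in> polys"
    "\<And>\<gamma> w. (\<forall>i. ((\<lambda>z. \<gamma> z $ i) has_field_derivative w $ i) (at 0)) \<Longrightarrow>
      ((\<lambda>z. p (\<gamma> z)) has_field_derivative scalar_product (G (\<gamma> 0)) w) (at 0)"
    and H: "\<And>i. (\<lambda>x. H x $ i) \<in> polys"
    "\<And>\<gamma> w. (\<forall>i. ((\<lambda>z. \<gamma> z $ i) has_field_derivative w $ i) (at 0)) \<Longrightarrow>
      ((\<lambda>z. q (\<gamma> z)) has_field_derivative scalar_product (H (\<gamma> 0)) w) (at 0)"
    by blast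
  show ?case
  proof (intro exI[of _ "\<lambda>x. G x + H x"] conjI allI impI)
    show "(\<lambda>x. (G x + H x) $ i) \<in> polys" for i
      using polys.add[OF G(1) H(1)] by simp
    fix \<gamma> :: "complex \<Rightarrow> complex ^ 'n" and w
    assume "\<forall>i. ((\<lambda>z. \<gamma> z $ i) has_field_derivative w $ i) (at 0)"
    from DERIV_add[OF G(2)[OF this] H(2)[OF this]]
    show "((\<lambda>z. p (\<gamma> z) + q (\<gamma> z)) has_field_derivative
        scalar_product (G (\<gamma> 0) + H (\<gamma> 0)) w) (at 0)"
      by (simp add: scalar_product_def ring_distribs sum.distrib)
  qed
next
  case (mult p q)
  then obtain G H where G: "\<And>i. (\<lambda>x. G x $ i) \<in> polys"
    "\<And>\<gamma> w. (\<forall>i. ((\<lambda>z. \<gamma> z $ i) has_field_derivative w $ i) (at 0)) \<Longrightarrow>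
      ((\<lambda>z. p (\<gamma> z)) has_field_derivative scalar_product (G (\<gamma> 0)) w) (at 0)"
    and H: "\<And>i. (\<lambda>x. H x $ i) \<in> polys"
    "\<And>\<gamma> w. (\<forall>i. ((\<lambda>z. \<gamma> z $ i) has_field_derivative w $ i) (at 0)) \<Longrightarrow>
      ((\<lambda>z. q (\<gamma> z)) has_field_derivative scalar_product (H (\<gamma> 0)) w) (at 0)"
    by blast
  show ?case
  proof (intro exI[of _ "\<lambda>x. q x *s G x + p x *s H x"] conjI allI impI)
    show "(\<lambda>x. (q x *s G x + p x *s H x) $ i) \<in> polys" for i
      using polys.add[OF polys.mult[OF mult(2) G(1)] polys.mult[OF mult(1) H(1)]] by simp
    fix \<gamma> :: "complex \<Rightarrow> complex ^ 'n" and w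
    assume "\<forall>i. ((\<lambda>z. \<gamma> z $ i) has_field_derivative w $ i) (at 0)"
    from DERIV_mult[OF G(2)[OF this] H(2)[OF this]]
    show "((\<lambda>z. p (\<gamma> z) * q (\<gamma> z)) has_field_derivative
        scalar_product (q (\<gamma> 0) *s G (\<gamma> 0) + p (\<gamma> 0) *s H (\<gamma> 0)) w) (at 0)"
      by (simp add: scalar_product_def ring_distribs sum.distrib sum_distrib_left mult_ac)
  qed
qed

lemma has_field_derivative_along_line:
  "((\<lambda>t. (x + t *s v) $ i) has_field_derivative (v :: complex ^ 'n) $ i) (at 0)"
  by (auto intro!: derivative_eq_intros)

lemma poly_gradient_eq_grad:
  fixes f :: "complex ^ 'n \<Rightarrow> complex"
  assumes "\<And>\<gamma> w. \<forall>i. ((\<lambda>z. \<gamma> z $ i) has_field_derivative w $ i) (at 0) \<Longrightarrow>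
      ((\<lambda>z. f (\<gamma> z)) has_field_derivative scalar_product (G (\<gamma> 0)) w) (at 0)"
  shows "G = grad f"
proof
  fix x
  have "((\<lambda>t. f (x + t *s axis i 1)) has_field_derivative G x $ i) (at 0)" for i
    using assms[OF allI[OF has_field_derivative_along_line[of x "axis i 1"]]]
    by (simp add: scalar_product_axis)
  then show "G x = grad f x"
    by (simp add: vec_eq_iff grad_def DERIV_imp_deriv[symmetric])
qed

lemma
  fixes f :: "complex ^ 'n \<Rightarrow> complex"
  assumes "f \<in> polys"
  shows polys_grad: "(\<lambda>x. grad f x $ i) \<in> polys"
    and has_field_derivative_poly_curve:
      "(\<And>i. ((\<lambda>z. \<gamma> z $ i) has_field_derivative w $ i) (at 0)) \<Longrightarrow>
        ((\<lambda>z. f (\<gamma> z)) has_field_derivative scalar_product (grad f (\<gamma> 0)) w) (at 0)"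
  using ex_poly_gradient[OF assms] poly_gradient_eq_grad[of f] by blast+

lemma has_field_derivative_poly_line:
  fixes f :: "complex ^ 'n \<Rightarrow> complex"
  assumes "f \<in> polys"
  shows "((\<lambda>t. f (x + t *s v)) has_field_derivative scalar_product (grad f x) v) (at 0)"
  using has_field_derivative_poly_curve[OF assms has_field_derivative_along_line] by simp

lemma grad_linear_combination:
  fixes f h :: "complex ^ 'n \<Rightarrow> complex"
  assumes "f \<in> polys" "h \<in> polys"
  shows "grad (\<lambda>x. a * f x + b * h x) x = a *s grad f x + b *s grad h x"
proof -
  have "((\<lambda>t. a * f (x + t *s axis i 1) + b * h (x + t *s axis i 1)) has_field_derivative
      (a * grad f x $ i + b * grad h x $ i)) (at 0)" for i
    using has_field_derivative_poly_line[OF assms(1), of x "axis i 1"]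
      has_field_derivative_poly_line[OF assms(2), of x "axis i 1"]
    by (auto intro!: derivative_eq_intros simp: scalar_product_axis)
  then have "grad (\<lambda>x. a * f x + b * h x) x $ i = a * grad f x $ i + b * grad h x $ i" for i
    unfolding grad_def[of "\<lambda>x. a * f x + b * h x"] by (simp add: DERIV_imp_deriv)
  then show ?thesis by (simp add: vec_eq_iff)
qed

lemma vanishing_ideal_linear_combination:
  "f \<in> vanishing_ideal X \<Longrightarrow> h \<in> vanishing_ideal X \<Longrightarrow> (\<lambda>x. a * f x + b * h x) \<in> vanishing_ideal X"
  by (auto simp: vanishing_ideal_def intro!: polys.add polys.mult polys.const)

lemma conormal_linear_combination:
  assumes "y \<in> conormal X x" "z \<in> conormal X x"
  shows "a *s y + b *s z \<in> conormal X x"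
proof -
  obtain f h where "y = grad f x" "f \<in> vanishing_ideal X" "z = grad h x" "h \<in> vanishing_ideal X"
    using assms by (auto simp: conormal_def)
  then show ?thesis
    using grad_linear_combination[of f h a b x] vanishing_ideal_linear_combination[of f X h a b]
    unfolding conormal_def by (force simp: vanishing_ideal_def)
qed

lemma subspace_conormal: "vec.subspace (conormal X x)"
proof -
  have "(\<lambda>_. 0) \<in> vanishing_ideal X" by (simp add: vanishing_ideal_def polys.const)
  then obtain y where y: "y \<in> conormal X x" by (auto simp: conormal_def)
  show ?thesis
    using conormal_linear_combination[OF y y, of 0 0] conormal_linear_combination[of _ X x _ 1 1]
      conormal_linear_combination[of _ X x _ _ 0]
    by (auto simp: vec.subspace_def)
qed

lemma tangent_space_eq_annihilator: "tangent_space X x = annihilator (conormal X x)"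
proof -
  have "deriv (\<lambda>t. f (x + t *s v)) 0 = scalar_product (grad f x) v" if "f \<in> vanishing_ideal X" for f v
    using that by (intro DERIV_imp_deriv has_field_derivative_poly_line) (simp add: vanishing_ideal_def)
  then show ?thesis
    by (auto simp: tangent_space_def annihilator_def conormal_def)
qed

text \<open>The normal space is the double annihilator of the conormal space, which is a subspace.
  So each normal vector is the gradient of one polynomial vanishing on \<open>X\<close>, and thereby
  extends to a polynomial family of normal vectors.\<close>

lemma ED_normal_space_eq_conormal: "ED_normal_space X x = conormal X x"
proof -
  have "ED_normal_space X x = annihilator (tangent_space X x)"
    unfolding ED_normal_space_def annihilator_def[of "tangent_space X x"]
    by (simp only: scalar_product_commute)
  then show ?thesis
    by (simp add: tangent_space_eq_annihilator annihilator_annihilator subspace_conormal)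
qed

text \<open>
  The rows of \<open>M\<close> outside \<open>B\<close> are a constant complement: they turn the local frame of
  conormal vectors into a square matrix, so that Cramer's rule yields coordinates.
\<close>

definition conormal_frame ::
    "(complex ^ 'n) set \<Rightarrow> 'n set \<Rightarrow> (complex ^ 'n \<Rightarrow> complex ^ 'n ^ 'n) \<Rightarrow> bool" where
  "conormal_frame X B M \<longleftrightarrow>
     (\<forall>i j. (\<lambda>x. M x $ i $ j) \<in> polys) \<and>
     (\<forall>i\<in>B. \<exists>f\<in>vanishing_ideal X. \<forall>x. M x $ i = grad f x)"

text \<open>A basis of the conormal space at \<open>x\<close> consists of gradients and is completed
  by constant vectors. Letting the gradients vary with the point gives \<open>M\<close>.\<close>

lemma ex_conormal_frame:
  fixes X :: "(complex ^ 'n) set"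
  obtains B M where "conormal_frame X B M" "det (M x) \<noteq> 0"
    "vec.dim (tangent_space X x) = CARD('n) - card B"
proof -
  obtain A :: "complex ^ 'n ^ 'n" and B where A: "det A \<noteq> 0" "conormal X x = row_combinations A B"
    "\<And>i. i \<in> B \<Longrightarrow> A $ i \<in> conormal X x"
    using subspace_eq_row_combinations[OF subspace_conormal] by metis
  have "\<exists>f. f \<in> vanishing_ideal X \<and> A $ i = grad f x" if "i \<in> B" for i
    using A(3)[OF that] by (auto simp: conormal_def)
  then obtain \<phi> where \<phi>: "\<And>i. i \<in> B \<Longrightarrow> \<phi> i \<in> vanishing_ideal X \<and> A $ i = grad (\<phi> i) x"
    by metis
  define M where "M y = (\<chi> i. if i \<in> B then grad (\<phi> i) y else A $ i)" for y
  have "(\<lambda>y. M y $ i $ j) \<in> polys" for i j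
    using \<phi> by (cases "i \<in> B") (auto simp: M_def vanishing_ideal_def intro: polys_grad polys.const)
  then have "conormal_frame X B M"
    unfolding conormal_frame_def using \<phi> by (auto simp: M_def)
  moreover have "M x = A"
    using \<phi> by (simp add: M_def vec_eq_iff)
  ultimately show ?thesis
    using that A dim_annihilator_row_combinations[OF A(1), of B]
    by (metis tangent_space_eq_annihilator)
qed

lemma row_combinations_subset_conormal:
  assumes "conormal_frame X B M"
  shows "row_combinations (M x) B \<subseteq> conormal X x"
proof
  fix y assume "y \<in> row_combinations (M x) B"
  then obtain c where c: "y = c v* M x" "\<forall>i. i \<notin> B \<longrightarrow> c $ i = 0"
    by (auto simp: row_combinations_def)
  show "y \<in> conormal X x"
    unfolding c(1) vector_matrix_mult_rows
  proof (rule vec.subspace_sum[OF subspace_conormal])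
    fix i
    have "M x $ i \<in> conormal X x" if "i \<in> B"
      using assms that unfolding conormal_frame_def conormal_def by blast
    then show "c $ i *s M x $ i \<in> conormal X x"
      using c(2) vec.subspace_scale[OF subspace_conormal] vec.subspace_0[OF subspace_conormal]
      by (cases "i \<in> B") auto
  qed
qed

text \<open>Upper semicontinuity of the tangent dimension: where the determinant is nonzero the
  \<open>card B\<close> gradients remain independent, and tangent vectors are orthogonal to all of
  them.\<close>

lemma dim_tangent_space_le:
  fixes X :: "(complex ^ 'n) set"
  assumes "conormal_frame X B M" "det (M x) \<noteq> 0"
  shows "vec.dim (tangent_space X x) \<le> CARD('n) - card B"
  unfolding tangent_space_eq_annihilator dim_annihilator_row_combinations[OF assms(2), symmetric]
  by (intro vec.dim_subset annihilator_antimono row_combinations_subset_conormal assms)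

text \<open>The annihilators of the two sides are nested, and the dimension hypothesis forces them
  to agree; biduality brings the equality back.\<close>

lemma conormal_eq_row_combinations:
  fixes X :: "(complex ^ 'n) set"
  assumes "conormal_frame X B M" "det (M x) \<noteq> 0"
    and "CARD('n) - card B \<le> vec.dim (tangent_space X x)"
  shows "conormal X x = row_combinations (M x) B"
proof -
  have "annihilator (conormal X x) = annihilator (row_combinations (M x) B)"
    using assms(3) dim_annihilator_row_combinations[OF assms(2), of B]
    by (intro vec.subspace_dim_equal subspace_annihilator annihilator_antimono
        row_combinations_subset_conormal[OF assms(1)]) (simp add: tangent_space_eq_annihilator)
  then show ?thesis
    by (metis annihilator_annihilator subspace_conormal subspace_row_combinations)
qed


section \<open>Krull dimension of a rational variety\<close>

lemma homogeneous_system_nontrivial: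
  fixes a :: "'a \<Rightarrow> 'b \<Rightarrow> 'c :: field"
  assumes "finite B" "finite A" "card B < card A"
  shows "\<exists>c. (\<exists>\<alpha>\<in>A. c \<alpha> \<noteq> 0) \<and> (\<forall>\<beta>\<in>B. (\<Sum>\<alpha>\<in>A. c \<alpha> * a \<alpha> \<beta>) = 0)"
  using assms
proof (induction B arbitrary: A a rule: finite_induct)
  case empty
  then have "A \<noteq> {}" by auto
  then show ?case by (intro exI[of _ "\<lambda>_. 1"]) auto
next
  case (insert \<beta>\<^sub>0 B)
  show ?case
  proof (cases "\<forall>\<alpha>\<in>A. a \<alpha> \<beta>\<^sub>0 = 0")
    case True
    with insert.IH[of A a] insert.prems insert.hyps show ?thesis by simp
  next
    case False
    then obtain \<alpha>\<^sub>0 where \<alpha>\<^sub>0: "\<alpha>\<^sub>0 \<in> A" "a \<alpha>\<^sub>0 \<beta>\<^sub>0 \<noteq> 0" by auto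
    define r where "r \<alpha> = a \<alpha> \<beta>\<^sub>0 / a \<alpha>\<^sub>0 \<beta>\<^sub>0" for \<alpha>
    let ?A = "A - {\<alpha>\<^sub>0}"
    have "card B < card ?A" "finite ?A"
      using insert.prems insert.hyps \<alpha>\<^sub>0(1) by auto
    then obtain c where c: "\<exists>\<alpha>\<in>?A. c \<alpha> \<noteq> 0"
      "\<And>\<beta>. \<beta> \<in> B \<Longrightarrow> (\<Sum>\<alpha>\<in>?A. c \<alpha> * (a \<alpha> \<beta> - r \<alpha> * a \<alpha>\<^sub>0 \<beta>)) = 0"
      using insert.IH[of ?A "\<lambda>\<alpha> \<beta>. a \<alpha> \<beta> - r \<alpha> * a \<alpha>\<^sub>0 \<beta>"] by blast
    \<comment> \<open>The value at \<open>\<alpha>\<^sub>0\<close> comes from solving the equation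
      \<open>\<beta>\<^sub>0\<close> for that unknown.\<close>
    define c' where "c' = c(\<alpha>\<^sub>0 := - (\<Sum>\<alpha>\<in>?A. c \<alpha> * r \<alpha>))"
    have "(\<Sum>\<alpha>\<in>A. c' \<alpha> * a \<alpha> \<beta>) = 0" if "\<beta> \<in> insert \<beta>\<^sub>0 B" for \<beta>
    proof -
      have "(\<Sum>\<alpha>\<in>A. c' \<alpha> * a \<alpha> \<beta>) = c' \<alpha>\<^sub>0 * a \<alpha>\<^sub>0 \<beta> + (\<Sum>\<alpha>\<in>?A. c' \<alpha> * a \<alpha> \<beta>)"
        using \<alpha>\<^sub>0(1) insert.prems by (simp add: sum.remove)
      also have "(\<Sum>\<alpha>\<in>?A. c' \<alpha> * a \<alpha> \<beta>) = (\<Sum>\<alpha>\<in>?A. c \<alpha> * a \<alpha> \<beta>)"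
        by (intro sum.cong) (auto simp: c'_def)
      also have "c' \<alpha>\<^sub>0 * a \<alpha>\<^sub>0 \<beta> = - (\<Sum>\<alpha>\<in>?A. c \<alpha> * (r \<alpha> * a \<alpha>\<^sub>0 \<beta>))"
        by (simp add: c'_def sum_distrib_right mult.assoc)
      also have "- (\<Sum>\<alpha>\<in>?A. c \<alpha> * (r \<alpha> * a \<alpha>\<^sub>0 \<beta>)) + (\<Sum>\<alpha>\<in>?A. c \<alpha> * a \<alpha> \<beta>) =
          (\<Sum>\<alpha>\<in>?A. c \<alpha> * (a \<alpha> \<beta> - r \<alpha> * a \<alpha>\<^sub>0 \<beta>))"
        by (simp add: right_diff_distrib sum_subtractf)
      also have "\<dots> = 0"
        using that c(2) \<alpha>\<^sub>0(2) by (cases "\<beta> = \<beta>\<^sub>0") (simp_all add: r_def)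
      finally show ?thesis .
    qed
    moreover have "\<exists>\<alpha>\<in>A. c' \<alpha> \<noteq> 0"
      using c(1) by (auto simp: c'_def)
    ultimately show ?thesis by blast
  qed
qed

section \<open>Degrees in each variable and vanishing on grids\<close>

definition partial_degree_le :: "((nat \<Rightarrow> complex) \<Rightarrow> complex) \<Rightarrow> nat \<Rightarrow> bool" where
  "partial_degree_le P D \<longleftrightarrow> (\<forall>t i. \<exists>p. degree p \<le> D \<and> (\<forall>z. P (t(i := z)) = poly p z))"

lemma partial_degree_le_const: "partial_degree_le (\<lambda>_. a) D"
  unfolding partial_degree_le_def by (intro allI exI[of _ "[:a:]"]) auto

lemma partial_degree_le_mono: "partial_degree_le P D \<Longrightarrow> D \<le> E \<Longrightarrow> partial_degree_le P E"
  unfolding partial_degree_le_def by (meson order_trans)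

lemma partial_degree_le_add:
  assumes "partial_degree_le P D" "partial_degree_le Q D"
  shows "partial_degree_le (\<lambda>t. P t + Q t) D"
  unfolding partial_degree_le_def
proof (intro allI)
  fix t i
  obtain p q where "degree p \<le> D" "\<And>z. P (t(i := z)) = poly p z"
    "degree q \<le> D" "\<And>z. Q (t(i := z)) = poly q z"
    using assms unfolding partial_degree_le_def by metis
  then show "\<exists>p. degree p \<le> D \<and> (\<forall>z. P (t(i := z)) + Q (t(i := z)) = poly p z)"
    by (intro exI[of _ "p + q"]) (auto intro: degree_add_le)
qed

lemma partial_degree_le_mult:
  assumes "partial_degree_le P D" "partial_degree_le Q E"
  shows "partial_degree_le (\<lambda>t. P t * Q t) (D + E)"
  unfolding partial_degree_le_def
proof (intro allI)
  fix t i
  obtain p q where "degree p \<le> D" "\<And>z. P (t(i := z)) = poly p z"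
    "degree q \<le> E" "\<And>z. Q (t(i := z)) = poly q z"
    using assms unfolding partial_degree_le_def by metis
  then show "\<exists>p. degree p \<le> D + E \<and> (\<forall>z. P (t(i := z)) * Q (t(i := z)) = poly p z)"
    by (intro exI[of _ "p * q"]) (auto intro: order_trans[OF degree_mult_le])
qed

lemma partial_degree_le_sum:
  "(\<And>a. a \<in> A \<Longrightarrow> partial_degree_le (P a) D) \<Longrightarrow> partial_degree_le (\<lambda>t. \<Sum>a\<in>A. P a t) D"
  by (induction A rule: infinite_finite_induct)
    (auto intro: partial_degree_le_const partial_degree_le_add)

lemma partial_degree_le_power:
  "partial_degree_le P D \<Longrightarrow> partial_degree_le (\<lambda>t. P t ^ n) (n * D)"
  by (induction n) (auto intro: partial_degree_le_const partial_degree_le_mult)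

lemma partial_degree_le_prod:
  assumes "finite A" "\<And>a. a \<in> A \<Longrightarrow> partial_degree_le (P a) D"
  shows "partial_degree_le (\<lambda>t. \<Prod>a\<in>A. P a t) (card A * D)"
  using assms
  by (induction A rule: finite_induct)
    (auto intro: partial_degree_le_const partial_degree_le_mult)

lemma polys_partial_degree_le:
  assumes "P \<in> polys"
  shows "\<exists>D. partial_degree_le P D"
  using assms
proof induction
  case (coord c)
  then obtain j where "c = (\<lambda>t. t j)" by (auto simp: coords_seq_iff)
  have "\<exists>p :: complex poly. degree p \<le> 1 \<and> (\<forall>z. (t(i := z)) j = poly p z)" for t i
    by (cases "i = j") (auto intro: exI[of _ "[:0, 1:]"] exI[of _ "[:t j:]"])
  then show ?case
    unfolding partial_degree_le_def \<open>c = _\<close> by blast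
next
  case (add p q)
  then obtain D E where "partial_degree_le p D" "partial_degree_le q E" by auto
  then have "partial_degree_le (\<lambda>t. p t + q t) (max D E)"
    by (intro partial_degree_le_add) (auto elim: partial_degree_le_mono)
  then show ?case by blast
qed (blast intro: partial_degree_le_const partial_degree_le_mult)+

definition grid :: "nat \<Rightarrow> nat \<Rightarrow> (nat \<Rightarrow> complex) set" where
  "grid d D = (\<lambda>e i. if i < d then of_nat (e i) else 0) ` (PiE {..<d} (\<lambda>_. {..D}))"

lemma finite_grid: "finite (grid d D)"
  unfolding grid_def by (intro finite_imageI finite_PiE) auto

lemma card_grid_le: "card (grid d D) \<le> (D + 1) ^ d"
proof -
  have "card (grid d D) \<le> card (PiE {..<d} (\<lambda>_. {..D}))"
    unfolding grid_def by (intro card_image_le finite_PiE) auto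
  then show ?thesis by (simp add: card_PiE)
qed

lemma gridI:
  assumes "t \<in> affine_nspace d" "\<And>i. i < d \<Longrightarrow> t i \<in> of_nat ` {..D}"
  shows "t \<in> grid d D"
proof -
  have "\<forall>i. \<exists>n. i < d \<longrightarrow> n \<le> D \<and> t i = of_nat n" using assms(2) by fastforce
  then obtain e where e: "\<And>i. i < d \<Longrightarrow> e i \<le> D \<and> t i = of_nat (e i)" by metis
  then have "t = (\<lambda>i. if i < d then of_nat (restrict e {..<d} i) else 0)"
    using assms(1) by (auto simp: affine_nspace_def)
  moreover have "restrict e {..<d} \<in> PiE {..<d} (\<lambda>_. {..D})"
    using e by auto
  ultimately show ?thesis unfolding grid_def by blast
qed

text \<open>Freeing one coordinate at a time leaves a polynomial in one variable of degree at most
  \<open>D\<close> with \<open>D + 1\<close> roots. This is why the degree is bounded in each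
  variable separately.\<close>

lemma vanish_on_grid:
  assumes P: "partial_degree_le P D" and van: "\<And>t. t \<in> grid d D \<Longrightarrow> P t = 0"
    and t: "t \<in> affine_nspace d"
  shows "P t = 0"
proof -
  \<comment> \<open>For the induction the first \<open>j\<close> coordinates are arbitrary and the
    remaining ones are still integers in the grid; \<open>j = d\<close> is the claim.\<close>
  have "P t = 0"
    if "j \<le> d" "t \<in> affine_nspace d" "\<And>i. j \<le> i \<Longrightarrow> i < d \<Longrightarrow> t i \<in> of_nat ` {..D}" for j t
    using that
  proof (induction j arbitrary: t)
    case 0
    then show ?case by (intro van gridI) auto
  next
    case (Suc j)
    obtain p where p: "degree p \<le> D" "\<And>z. P (t(j := z)) = poly p z"
      using P unfolding partial_degree_le_def by blast
    have "poly p z = 0" if "z \<in> of_nat ` {..D}" for z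
      unfolding p(2)[symmetric] using that Suc.prems
      by (intro Suc.IH) (auto simp: affine_nspace_def)
    then have sub: "of_nat ` {..D} \<subseteq> {z. poly p z = 0}" by auto
    have "p = 0"
    proof (rule ccontr)
      assume "p \<noteq> 0"
      then have "card (of_nat ` {..D} :: complex set) \<le> degree p"
        using card_mono[OF poly_roots_finite sub] card_poly_roots_bound[of p] by simp
      moreover have "card (of_nat ` {..D} :: complex set) = D + 1"
        by (subst card_image) (auto intro: inj_onI)
      ultimately show False using p(1) by simp
    qed
    then show ?case using p(2)[of "t j"] by simp
  qed
  from this[of d t] t show ?thesis by simp
qed

section \<open>Algebraic relations and chains of subvarieties\<close>

abbreviation exponents :: "nat \<Rightarrow> nat \<Rightarrow> (nat \<Rightarrow> nat) set" where
  "exponents k N \<equiv> PiE {..<k} (\<lambda>_. {..N})"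

text \<open>
  The \<open>(N + 1) ^ k\<close> unknowns \<open>c \<alpha>\<close> outnumber the \<open>(O(N) + 1) ^ d\<close> conditions of vanishing on a grid.
\<close>

lemma algebraic_relation:
  assumes "d < k" and "\<And>i. i < k \<Longrightarrow> P i \<in> polys" "\<And>i. i < k \<Longrightarrow> Q i \<in> polys"
  shows "\<exists>N c. (\<exists>\<alpha>\<in>exponents k N. c \<alpha> \<noteq> 0) \<and> (\<forall>t\<in>affine_nspace d.
    (\<Sum>\<alpha>\<in>exponents k N. c \<alpha> * (\<Prod>i<k. P i t ^ \<alpha> i * Q i t ^ (N - \<alpha> i))) = 0)"
proof -
  have "\<forall>i. \<exists>D. i < k \<longrightarrow> partial_degree_le (P i) D \<and> partial_degree_le (Q i) D"
  proof
    fix i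
    show "\<exists>D. i < k \<longrightarrow> partial_degree_le (P i) D \<and> partial_degree_le (Q i) D"
    proof (cases "i < k")
      case True
      then obtain D E where "partial_degree_le (P i) D" "partial_degree_le (Q i) E"
        using assms(2,3) polys_partial_degree_le by blast
      then show ?thesis
        by (intro exI[of _ "max D E"]) (auto elim: partial_degree_le_mono)
    qed auto
  qed
  then obtain D' where D': "\<And>i. i < k \<Longrightarrow> partial_degree_le (P i) (D' i) \<and> partial_degree_le (Q i) (D' i)"
    by metis
  define D where "D = (\<Sum>i<k. D' i)"
  have D: "partial_degree_le (P i) D" "partial_degree_le (Q i) D" if "i < k" for i
    using D'[OF that] that member_le_sum[of i "{..<k}" D']
    by (auto simp: D_def elim: partial_degree_le_mono)
  \<comment> \<open>\<open>C\<close> is chosen so that \<open>E + 1 \<le> C * (N + 1)\<close>. The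
    \<open>d\<close>-th power then costs a factor \<open>C ^ d\<close>; taking \<open>N\<close>
    equal to it gives \<open>N * (N + 1) ^ d\<close>, which is below
    \<open>(N + 1) ^ Suc d\<close>.\<close>
  define C where "C = k * D + 1"
  define N where "N = C ^ d"
  define E where "E = k * (N * D)"
  \<comment> \<open>This is the monomial with exponents \<alpha> in the quotients
    \<open>P i / Q i\<close>, cleared of denominators by the factor \<open>Q i ^ N\<close> for each
    \<open>i\<close>, which does not depend on \<alpha>.\<close>
  define G where "G \<alpha> t = (\<Prod>i<k. P i t ^ \<alpha> i * Q i t ^ (N - \<alpha> i))" for \<alpha> t
  have G: "partial_degree_le (G \<alpha>) E" if "\<alpha> \<in> exponents k N" for \<alpha>
  proof -
    have "partial_degree_le (\<lambda>t. P i t ^ \<alpha> i * Q i t ^ (N - \<alpha> i)) (N * D)" if "i < k" for i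
    proof -
      have "\<alpha> i \<le> N" using \<open>\<alpha> \<in> _\<close> that by auto
      then have "\<alpha> i * D + (N - \<alpha> i) * D = N * D" by (simp flip: distrib_right)
      then show ?thesis
        using partial_degree_le_mult[OF partial_degree_le_power partial_degree_le_power, OF D[OF that]]
        by metis
    qed
    then show ?thesis
      using partial_degree_le_prod[of "{..<k}" "\<lambda>i t. P i t ^ \<alpha> i * Q i t ^ (N - \<alpha> i)" "N * D"]
      by (simp add: G_def[abs_def] E_def)
  qed
  have "card (grid d E) \<le> (E + 1) ^ d"
    by (rule card_grid_le)
  also have "\<dots> \<le> (C * (N + 1)) ^ d"
    by (intro power_mono) (auto simp: E_def C_def algebra_simps)
  also have "\<dots> = N * (N + 1) ^ d"
    by (simp only: N_def power_mult_distrib)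
  also have "\<dots> < (N + 1) ^ Suc d" by simp
  also have "\<dots> \<le> (N + 1) ^ k"
    using assms(1) by (intro power_increasing) auto
  also have "\<dots> = card (exponents k N)" by (simp add: card_PiE)
  finally obtain c where c: "\<exists>\<alpha>\<in>exponents k N. c \<alpha> \<noteq> 0"
    "\<And>t. t \<in> grid d E \<Longrightarrow> (\<Sum>\<alpha>\<in>exponents k N. c \<alpha> * G \<alpha> t) = 0"
    using homogeneous_system_nontrivial[of "grid d E" "exponents k N" G] finite_grid
    by (auto simp: finite_PiE)
  have "partial_degree_le (\<lambda>t. \<Sum>\<alpha>\<in>exponents k N. c \<alpha> * G \<alpha> t) E"
    using partial_degree_le_mult[OF partial_degree_le_const[of _ 0] G]
    by (intro partial_degree_le_sum) auto
  then have "\<forall>t\<in>affine_nspace d. (\<Sum>\<alpha>\<in>exponents k N. c \<alpha> * G \<alpha> t) = 0"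
    using vanish_on_grid c(2) by blast
  with c(1) show ?thesis unfolding G_def by blast
qed

lemma sum_exponents_Suc:
  "(\<Sum>\<alpha>\<in>exponents (Suc k) N. h \<alpha>) = (\<Sum>j\<le>N. \<Sum>\<alpha>\<in>exponents k N. h (\<alpha>(k := j)))"
proof -
  let ?m = "\<lambda>(j, \<alpha>). \<alpha>(k := j)"
  have "exponents (Suc k) N = ?m ` ({..N} \<times> exponents k N)"
    unfolding lessThan_Suc by (rule PiE_insert_eq)
  moreover have "inj_on ?m ({..N} \<times> exponents k N)"
    by (rule inj_combinator) auto
  ultimately show ?thesis
    by (simp add: sum.reindex sum.cartesian_product case_prod_unfold o_def)
qed

text \<open>Order the relation by powers of the last function \<open>F k\<close>. On the irreducible
  \<open>Y (Suc k)\<close> a power of \<open>F k\<close> can be cancelled; restricting to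
  \<open>Y k\<close>, where \<open>F k\<close> vanishes, isolates the lowest coefficient. It is a
  relation among the earlier functions, so induction applies to it.\<close>

lemma chain_algebraically_independent:
  fixes F :: "nat \<Rightarrow> 'a :: affine_coords \<Rightarrow> complex"
  assumes irr: "\<And>i. i \<le> k \<Longrightarrow> zariski_irreducible (Y i)"
    and mono: "\<And>i. i < k \<Longrightarrow> Y i \<subseteq> Y (Suc i)"
    and F: "\<And>i. i < k \<Longrightarrow> F i \<in> polys" "\<And>i x. i < k \<Longrightarrow> x \<in> Y i \<Longrightarrow> F i x = 0"
      "\<And>i. i < k \<Longrightarrow> \<exists>x\<in>Y (Suc i). F i x \<noteq> 0"
    and rel: "\<And>x. x \<in> Y k \<Longrightarrow> (\<Sum>\<alpha>\<in>exponents k N. c \<alpha> * (\<Prod>i<k. F i x ^ \<alpha> i)) = 0"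
  shows "\<forall>\<alpha>\<in>exponents k N. c \<alpha> = 0"
  using assms
proof (induction k arbitrary: c)
  case 0
  \<comment> \<open>Without functions the relation is a single constant; nonemptiness of
    \<open>Y 0\<close> supplies a point at which to read it off.\<close>
  obtain x where "x \<in> Y 0"
    using "0.prems"(1)[of 0] by (auto simp: zariski_irreducible_def)
  with "0.prems"(6) show ?case by force
next
  case (Suc k)
  define Q where "Q j x = (\<Sum>\<alpha>\<in>exponents k N. c (\<alpha>(k := j)) * (\<Prod>i<k. F i x ^ \<alpha> i))" for j x
  have Qpoly: "Q j \<in> polys" for j
    unfolding Q_def[abs_def] using Suc.prems(3)
    by (intro polys_sum polys.mult polys.const polys_prod polys_power) auto
  have rel: "(\<Sum>j\<le>N. Q j x * F k x ^ j) = 0" if "x \<in> Y (Suc k)" for x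
  proof -
    have "(\<Prod>i<Suc k. F i x ^ (\<alpha>(k := j)) i) = (\<Prod>i<k. F i x ^ \<alpha> i) * F k x ^ j" for \<alpha> j
      by simp
    then have "(\<Sum>\<alpha>\<in>exponents (Suc k) N. c \<alpha> * (\<Prod>i<Suc k. F i x ^ \<alpha> i)) =
        (\<Sum>j\<le>N. Q j x * F k x ^ j)"
      unfolding sum_exponents_Suc Q_def by (simp add: sum_distrib_right mult.assoc)
    then show ?thesis using Suc.prems(6)[OF that] by simp
  qed
  have zero: "\<forall>\<alpha>\<in>exponents k N. c (\<alpha>(k := j)) = 0" if "j \<le> N" for j
    using that
  proof (induction j rule: less_induct)
    case (less j)
    have Q0: "Q i x = 0" if "i < j" for i x
      using less.IH[OF that] less.prems that unfolding Q_def by (intro sum.neutral ballI) (auto simp: fun_upd_def)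
    \<comment> \<open>The coefficients below \<open>j\<close> are already zero, so \<open>R\<close>
      is the relation divided by \<open>F k ^ j\<close>.\<close>
    define R where "R x = (\<Sum>i\<in>{j..N}. Q i x * F k x ^ (i - j))" for x
    have Rpoly: "R \<in> polys"
      unfolding R_def[abs_def] using Suc.prems(3) Qpoly
      by (intro polys_sum polys.mult polys_power) auto
    have FR: "F k x ^ j * R x = 0" if "x \<in> Y (Suc k)" for x
    proof -
      have "(\<Sum>i\<le>N. Q i x * F k x ^ i) = (\<Sum>i\<in>{j..N}. Q i x * F k x ^ i)"
        using Q0 by (intro sum.mono_neutral_right) auto
      also have "\<dots> = F k x ^ j * R x"
        unfolding R_def sum_distrib_left
        by (intro sum.cong refl) (auto simp: mult.left_commute simp flip: power_add)
      finally show ?thesis using rel[OF that] by simp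
    qed
    \<comment> \<open>\<open>F k\<close> is not identically zero on the irreducible set
      \<open>Y (Suc k)\<close>, so it is no zero divisor there.\<close>
    have R0: "R x = 0" if x: "x \<in> Y (Suc k)" for x
    proof (rule ccontr)
      assume "R x \<noteq> 0"
      moreover obtain y where "y \<in> Y (Suc k)" "F k y \<noteq> 0" using Suc.prems(5)[of k] by auto
      ultimately obtain z where "z \<in> Y (Suc k)" "R z \<noteq> 0" "F k z \<noteq> 0"
        using zariski_irreducibleD[OF Suc.prems(1)[OF order_refl] Rpoly Suc.prems(3)[OF lessI] x]
        by blast
      with FR[of z] show False by simp
    qed
    have "Q j x = 0" if "x \<in> Y k" for x
    proof -
      have "F k x = 0" using Suc.prems(4) that by simp
      \<comment> \<open>Only the exponent \<open>i - j = 0\<close> survives, because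
        \<open>0 ^ 0 = 1\<close>.\<close>
      then have "R x = (\<Sum>i\<in>{j..N}. if i = j then Q i x else 0)"
        unfolding R_def by (intro sum.cong) auto
      then show ?thesis
        using R0[of x] Suc.prems(2)[of k] that less.prems by auto
    qed
    then show ?case
      unfolding Q_def using Suc.prems(1-5) by (intro Suc.IH) (auto simp: fun_upd_def)
  qed
  show ?case
  proof
    fix \<alpha> assume "\<alpha> \<in> exponents (Suc k) N"
    then obtain j \<beta> where "j \<le> N" "\<beta> \<in> exponents k N" "\<alpha> = \<beta>(k := j)"
      unfolding lessThan_Suc PiE_insert_eq by auto
    with zero show "c \<alpha> = 0" by auto
  qed
qed

section \<open>Bounding the dimension by the number of parameters\<close>

lemma birationalE:
  assumes "birational X Y"
  obtains U f V g x where "rational_map X Y U f" "rational_map Y X V g"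
    "x \<in> U" "f x \<in> V" "\<And>x. x \<in> U \<Longrightarrow> f x \<in> V \<Longrightarrow> g (f x) = x"
    "\<And>y. y \<in> V \<Longrightarrow> g y \<in> U \<Longrightarrow> f (g y) = y"
  using assms unfolding birational_def by blast

lemma rational_map_subset: "rational_map X Y U f \<Longrightarrow> U \<subseteq> X"
  unfolding rational_map_def openin_subtopology by auto

lemma rational_map_in: "rational_map X Y U f \<Longrightarrow> x \<in> U \<Longrightarrow> f x \<in> Y"
  unfolding rational_map_def by auto

lemma rational_map_regular:
  "rational_map X Y U f \<Longrightarrow> p \<in> polys \<Longrightarrow> regular_function U (\<lambda>x. p (f x))"
  using regular_function_polys_compose[of p U f] unfolding rational_map_def by blast

text \<open>Strict inclusions provide equations \<open>F i\<close> of \<open>Y i\<close> that are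
  not identically zero on the next member. Pulled back by \<open>g\<close> they are \<open>k\<close>
  quotients in \<open>d\<close> parameters, hence related if \<open>d < k\<close>. By
  \<open>f\<close> the relation holds on a nonempty open part of \<open>X\<close>, by irreducibility
  on \<open>X\<close>, and so on \<open>Y k\<close>, against independence along the chain.\<close>

lemma zariski_dim_le_birational:
  fixes X :: "'a :: affine_coords set"
  assumes irr: "zariski_irreducible X" and bir: "birational X (affine_nspace d)"
  shows "zariski_dim X \<le> enat d"
  unfolding zariski_dim_def
proof (rule Sup_least, clarify)
  fix k and Y :: "nat \<Rightarrow> 'a set"
  assume Y: "\<forall>i\<le>k. affine_variety (Y i) \<and> Y i \<subseteq> X" and strict: "\<forall>i<k. Y i \<subset> Y (Suc i)"
  have "\<exists>F. F \<in> polys \<and> (\<forall>x\<in>Y i. F x = 0) \<and> (\<exists>x\<in>Y (Suc i). F x \<noteq> 0)" if i: "i < k" for i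
  proof -
    obtain H where H: "H \<subseteq> polys" "Y i = zeros H"
      using Y less_imp_le[OF i] unfolding affine_variety_def closedin_zariski by blast
    obtain x where "x \<in> Y (Suc i)" "x \<notin> Y i" using strict i by blast
    with H show ?thesis by (auto simp: zeros_def)
  qed
  then obtain F where F: "\<And>i. i < k \<Longrightarrow> F i \<in> polys" "\<And>i x. i < k \<Longrightarrow> x \<in> Y i \<Longrightarrow> F i x = 0"
      "\<And>i. i < k \<Longrightarrow> \<exists>x\<in>Y (Suc i). F i x \<noteq> 0"
    by metis
  have "\<not> d < k"
  proof
    assume "d < k"
    obtain U f V g x where fg: "rational_map X (affine_nspace d) U f"
      "rational_map (affine_nspace d) X V g" "x \<in> U" "f x \<in> V"
      "\<And>x. x \<in> U \<Longrightarrow> f x \<in> V \<Longrightarrow> g (f x) = x"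
      using birationalE[OF bir] by metis
    have "\<exists>p q. p \<in> polys \<and> q \<in> polys \<and> q (f x) \<noteq> 0 \<and>
        (\<forall>t\<in>V. q t \<noteq> 0 \<longrightarrow> F i (g t) = p t / q t)" if "i < k" for i
      using regular_functionE[OF rational_map_regular[OF fg(2) F(1)[OF that]] fg(4)] by metis
    then obtain P Q where PQ: "\<And>i. i < k \<Longrightarrow> P i \<in> polys" "\<And>i. i < k \<Longrightarrow> Q i \<in> polys"
      "\<And>i. i < k \<Longrightarrow> Q i (f x) \<noteq> 0"
      "\<And>i t. i < k \<Longrightarrow> t \<in> V \<Longrightarrow> Q i t \<noteq> 0 \<Longrightarrow> F i (g t) = P i t / Q i t"
      by metis
    obtain N c where c: "\<exists>\<alpha>\<in>exponents k N. c \<alpha> \<noteq> 0"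
      "\<And>t. t \<in> affine_nspace d \<Longrightarrow>
        (\<Sum>\<alpha>\<in>exponents k N. c \<alpha> * (\<Prod>i<k. P i t ^ \<alpha> i * Q i t ^ (N - \<alpha> i))) = 0"
      using algebraic_relation[where P = P and Q = Q, OF \<open>d < k\<close> PQ(1,2)] by auto
    define H where "H y = (\<Sum>\<alpha>\<in>exponents k N. c \<alpha> * (\<Prod>i<k. F i y ^ \<alpha> i))" for y
    have Hpoly: "H \<in> polys"
      unfolding H_def[abs_def] using F(1)
      by (intro polys_sum polys.mult polys.const polys_prod polys_power) auto
    \<comment> \<open>The common denominator of the quotients; it must not vanish at
      \<open>f y\<close> for the relation to be transported to \<open>y\<close>.\<close>
    define \<pi> where "\<pi> t = (\<Prod>i<k. Q i t)" for t
    have "\<pi> \<in> polys" unfolding \<pi>_def[abs_def] using PQ(2) by (intro polys_prod) auto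
    have opn: "openin (subtopology zariski (affine_nspace d)) ({t. \<pi> t \<noteq> 0} \<inter> V)"
      using fg(2) openin_Int[OF openin_poly_nonzero[OF \<open>\<pi> \<in> polys\<close>]]
      unfolding rational_map_def openin_subtopology by (metis Int_assoc)
    have "f x \<in> {t. \<pi> t \<noteq> 0} \<inter> V"
      using fg(4) PQ(3) by (simp add: \<pi>_def)
    from rational_map_preimage_open[OF fg(1) opn fg(3) this] obtain \<rho> where \<rho>: "\<rho> \<in> polys" "\<rho> x \<noteq> 0"
      "\<And>y. y \<in> X \<Longrightarrow> \<rho> y \<noteq> 0 \<Longrightarrow> y \<in> U \<and> \<pi> (f y) \<noteq> 0 \<and> f y \<in> V"
      by auto
    \<comment> \<open>At \<open>t = f y\<close> the numerator \<open>P i t\<close> equals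
      \<open>F i y * Q i t\<close>, so the relation becomes \<open>H y\<close> times a nonzero
      product of denominators.\<close>
    have H0: "H y = 0" if "y \<in> X" "\<rho> y \<noteq> 0" for y
    proof -
      let ?t = "f y"
      have y: "y \<in> U" "\<pi> ?t \<noteq> 0" "?t \<in> V" using \<rho>(3)[OF that] by auto
      have Q: "Q i ?t \<noteq> 0" if "i < k" for i using y(2) that by (auto simp: \<pi>_def)
      have "P i ?t ^ \<alpha> i * Q i ?t ^ (N - \<alpha> i) = F i y ^ \<alpha> i * Q i ?t ^ N"
        if "i < k" "\<alpha> \<in> exponents k N" for i \<alpha>
      proof -
        have "F i y = P i ?t / Q i ?t"
          using PQ(4)[OF that(1) y(3) Q[OF that(1)]] fg(5) y by simp
        then have "P i ?t = F i y * Q i ?t" using Q[OF that(1)] by simp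
        moreover have "\<alpha> i \<le> N" using that by auto
        ultimately show ?thesis
          by (simp add: power_mult_distrib mult.assoc flip: power_add)
      qed
      then have "0 = (\<Sum>\<alpha>\<in>exponents k N. c \<alpha> * (\<Prod>i<k. F i y ^ \<alpha> i * Q i ?t ^ N))"
        using c(2)[OF rational_map_in[OF fg(1) y(1)]] by simp
      also have "\<dots> = H y * (\<Prod>i<k. Q i ?t ^ N)"
        by (simp add: H_def prod.distrib sum_distrib_right mult.assoc)
      finally show ?thesis using Q by simp
    qed
    have "H y = 0" if y: "y \<in> X" for y
    proof (rule ccontr)
      assume "H y \<noteq> 0"
      then obtain z where "z \<in> X" "\<rho> z \<noteq> 0" "H z \<noteq> 0"
        using zariski_irreducibleD[OF irr \<rho>(1) Hpoly _ \<rho>(2) y] rational_map_subset[OF fg(1)] fg(3)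
        by auto
      with H0 show False by simp
    qed
    then have "\<forall>\<alpha>\<in>exponents k N. c \<alpha> = 0"
      using Y strict F unfolding H_def
      by (intro chain_algebraically_independent[where Y = Y and F = F])
        (auto simp: affine_variety_def)
    with c(1) show False by blast
  qed
  then show "enat k \<le> enat d" by simp
qed


section \<open>Tangent spaces of a rational variety\<close>

lemma isCont_eventually_nonzero:
  fixes h :: "'a :: t2_space \<Rightarrow> 'b :: {t1_space, zero}"
  assumes "isCont h a" "h a \<noteq> 0"
  shows "\<forall>\<^sub>F z in nhds a. h z \<noteq> 0"
  using assms tendsto_imp_eventually_ne[of h "h a" "nhds a" 0]
  by (simp add: isCont_def tendsto_at_iff_tendsto_nhds)

text \<open>The map \<open>g\<close> sends the \<open>d\<close> coordinate lines through
  \<open>f x\<close> to curves in \<open>X\<close> through \<open>x\<close>. Their velocities are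
  tangent to \<open>X\<close>, and differentiating \<open>f (g t) = t\<close> shows that they are
  independent.\<close>

lemma dim_tangent_space_ge_birational_point:
  fixes X :: "(complex ^ 'n) set"
  assumes f: "rational_map X (affine_nspace d) U f" and g: "rational_map (affine_nspace d) X V g"
    and gf: "g (f x) = x" and fg: "\<And>t. t \<in> V \<Longrightarrow> g t \<in> U \<Longrightarrow> f (g t) = t"
    and x: "x \<in> U" "f x \<in> V"
  shows "d \<le> vec.dim (tangent_space X x)"
proof -
  define t where "t = f x"
  have tA: "t \<in> affine_nspace d" and gt: "g t = x" and tV: "t \<in> V"
    using rational_map_in[OF f x(1)] gf x by (simp_all add: t_def)
  have "openin (subtopology zariski X) U" using f by (simp add: rational_map_def)
  from rational_map_preimage_open[OF g this tV] obtain \<sigma> where \<sigma>: "\<sigma> \<in> polys" "\<sigma> t \<noteq> 0"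
    "\<And>s. s \<in> affine_nspace d \<Longrightarrow> \<sigma> s \<noteq> 0 \<Longrightarrow> s \<in> V \<and> g s \<in> U"
    using gt x by auto
  define L where "L j z = t(j := t j + z)" for j z
  have L0: "L j 0 = t" for j by (simp add: L_def)
  have Lpoly: "(\<lambda>z. p (L j z)) \<in> polys" if "p \<in> polys" for p j
    using that
  proof (rule polys_compose)
    fix c :: "(nat \<Rightarrow> complex) \<Rightarrow> complex" assume "c \<in> coords"
    then obtain i where "c = (\<lambda>s. s i)" by (auto simp: coords_seq_iff)
    moreover have "(\<lambda>z. t j + z) \<in> polys" "(\<lambda>z. t i) \<in> polys"
      by (intro polys.add polys.const polys_ident)+
    ultimately show "(\<lambda>z. c (L j z)) \<in> polys"
      by (cases "i = j") (auto simp: L_def)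
  qed
  have ev_nz: "\<forall>\<^sub>F z in nhds 0. p (L j z) \<noteq> 0" if "p \<in> polys" "p t \<noteq> 0" for p j
  proof -
    have "isCont (\<lambda>z. p (L j z)) 0"
      using polys_complex_differentiable[OF Lpoly[OF that(1)]]
      by (rule field_differentiable_imp_continuous_at)
    then show ?thesis
      using isCont_eventually_nonzero[of 0 "\<lambda>z. p (L j z)"] that(2) by (simp add: L0)
  qed
  \<comment> \<open>The bound \<open>j < d\<close> keeps the line inside affine
    \<open>d\<close>-space, whose sequences vanish from index \<open>d\<close> on. The filter
    \<open>nhds 0\<close> includes the point 0 itself, as needed to compare derivatives
    there.\<close>
  have evL: "\<forall>\<^sub>F z in nhds 0. L j z \<in> V \<and> g (L j z) \<in> U \<and> f (g (L j z)) = L j z" if "j < d" for j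
    using ev_nz[OF \<sigma>(1,2), of j]
  proof eventually_elim
    case (elim z)
    moreover have "L j z \<in> affine_nspace d" using tA that by (auto simp: affine_nspace_def L_def)
    ultimately show ?case using \<sigma>(3) fg by auto
  qed
  define w where "w j = (\<chi> i. deriv (\<lambda>z. g (L j z) $ i) 0)" for j
  have w: "((\<lambda>z. g (L j z) $ i) has_field_derivative w j $ i) (at 0)" if "j < d" for i j
  proof -
    obtain p q where pq: "p \<in> polys" "q \<in> polys" "q t \<noteq> 0"
      "\<And>s. s \<in> V \<Longrightarrow> q s \<noteq> 0 \<Longrightarrow> g s $ i = p s / q s"
      using regular_functionE[OF rational_map_regular[OF g polys_nth] tV] by metis
    have ev: "\<forall>\<^sub>F z in nhds 0. g (L j z) $ i = p (L j z) / q (L j z)"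
      using evL[OF that] ev_nz[OF pq(2,3), of j] by eventually_elim (simp add: pq(4))
    have "(\<lambda>z. p (L j z) / q (L j z)) field_differentiable at 0"
      using pq(3) by (intro field_differentiable_divide polys_complex_differentiable Lpoly pq(1,2))
        (simp add: L0)
    then have "(\<lambda>z. g (L j z) $ i) field_differentiable at 0"
      unfolding field_differentiable_def using DERIV_cong_ev[OF refl ev refl] by simp
    then show ?thesis
      by (simp add: w_def field_differentiable_derivI)
  qed
  have curve: "((\<lambda>z. h (g (L j z))) has_field_derivative scalar_product (grad h x) (w j)) (at 0)"
    if "h \<in> polys" "j < d" for h j
    using has_field_derivative_poly_curve[OF that(1) w[OF that(2)]] by (simp add: L0 gt)
  have tangent: "w j \<in> tangent_space X x" if "j < d" for j
  proof -
    have "scalar_product (grad h x) (w j) = 0" if h: "h \<in> vanishing_ideal X" for h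
    proof -
      have "\<forall>\<^sub>F z in nhds 0. h (g (L j z)) = 0"
        using evL[OF \<open>j < d\<close>]
        by eventually_elim (use h rational_map_in[OF g] in \<open>auto simp: vanishing_ideal_def\<close>)
      then have "((\<lambda>z. h (g (L j z))) has_field_derivative 0) (at 0)"
        using DERIV_cong_ev[OF refl _ refl, of "\<lambda>z. h (g (L j z))" "\<lambda>_. 0"] by simp
      then show ?thesis
        using curve[of h j] h that DERIV_unique \<open>j < d\<close> by (auto simp: vanishing_ideal_def)
    qed
    then show ?thesis
      by (auto simp: tangent_space_eq_annihilator annihilator_def conormal_def)
  qed
  text \<open>
    Differentiating \<open>f \<circ> g = id\<close>, with \<open>f\<close> written as a quotient, gives functionals dual to
    the vectors \<open>w j\<close>.
  \<close>
  have "\<exists>l r. r \<noteq> 0 \<and> (\<forall>j<d. scalar_product l (w j) = (if j = i then r else 0))" for i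
  proof -
    obtain p q where pq: "p \<in> polys" "q \<in> polys" "q x \<noteq> 0"
      "\<And>y. y \<in> U \<Longrightarrow> q y \<noteq> 0 \<Longrightarrow> f y i = p y / q y"
      using regular_functionE[OF rational_map_regular[OF f polys_apply] x(1)] by metis
    \<comment> \<open>Since \<open>t i = p x / q x\<close>, this functional is \<open>q x\<close>
      times the differential of \<open>p / q\<close> at \<open>x\<close>.\<close>
    have "scalar_product (grad p x - t i *s grad q x) (w j) = (if j = i then q x else 0)"
      if "j < d" for j
    proof -
      note dp = curve[OF pq(1) that] and dq = curve[OF pq(2) that]
      have "\<forall>\<^sub>F z in nhds 0. q (g (L j z)) \<noteq> 0"
        using isCont_eventually_nonzero[OF DERIV_isCont[OF dq]] pq(3) by (simp add: L0 gt)
      then have ev: "\<forall>\<^sub>F z in nhds 0. p (g (L j z)) = L j z i * q (g (L j z))"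
        using evL[OF that]
      proof eventually_elim
        case (elim z)
        then show ?case using pq(4)[of "g (L j z)"] by (simp add: field_simps)
      qed
      have "((\<lambda>z. L j z i) has_field_derivative (if j = i then 1 else 0)) (at 0)"
        by (auto simp: L_def intro!: derivative_eq_intros)
      from DERIV_mult[OF this dq]
      have "((\<lambda>z. p (g (L j z))) has_field_derivative
          (if j = i then 1 else 0) * q x + scalar_product (grad q x) (w j) * t i) (at 0)"
        using DERIV_cong_ev[OF refl ev refl] by (simp add: L0 gt)
      from DERIV_unique[OF dp this]
      have "scalar_product (grad p x) (w j) - t i * scalar_product (grad q x) (w j) =
          (if j = i then q x else 0)"
        by simp
      moreover have "scalar_product (grad p x - t i *s grad q x) (w j) =
          scalar_product (grad p x) (w j) - t i * scalar_product (grad q x) (w j)"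
        by (simp add: scalar_product_def left_diff_distrib sum_subtractf sum_distrib_left mult.assoc)
      ultimately show ?thesis by simp
    qed
    then show ?thesis using pq(3) by blast
  qed
  then obtain l r where l: "\<And>i. r i \<noteq> 0"
    "\<And>i j. j < d \<Longrightarrow> scalar_product (l i) (w j) = (if j = i then r i else 0)"
    by metis
  have inj: "inj_on w {..<d}"
    using l by (intro inj_onI) (metis lessThan_iff)
  have "vec.independent (w ` {..<d})"
  proof (rule vec.independent_if_scalars_zero)
    fix u v assume u: "(\<Sum>v\<in>w ` {..<d}. u v *s v) = 0" and "v \<in> w ` {..<d}"
    then obtain i where i: "i < d" "v = w i" by auto
    have "0 = scalar_product (l i) (\<Sum>j<d. u (w j) *s w j)"
      using u by (simp add: sum.reindex[OF inj] scalar_product_def)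
    also have "\<dots> = (\<Sum>j<d. u (w j) * scalar_product (l i) (w j))"
      unfolding scalar_product_def sum_component sum_distrib_left
      by (subst sum.swap) (simp add: mult_ac)
    also have "\<dots> = (\<Sum>j<d. if j = i then u (w i) * r i else 0)"
      by (intro sum.cong) (auto simp: l(2))
    also have "\<dots> = u v * r i" using i by simp
    finally show "u v = 0" using l(1) by simp
  qed simp
  then have "card (w ` {..<d}) \<le> vec.dim (tangent_space X x)"
    using tangent by (intro vec.independent_card_le_dim) auto
  then show ?thesis by (simp add: card_image[OF inj])
qed

text \<open>A frame at \<open>y\<close> shows that on an open part of \<open>X\<close> the tangent
  dimension is at most its value at \<open>y\<close>. By irreducibility that part contains a point
  \<open>z\<close> of the birational locus, where the dimension is at least
  \<open>d\<close>.\<close>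

lemma dim_tangent_space_ge:
  fixes X :: "(complex ^ 'n) set"
  assumes irr: "zariski_irreducible X" and bir: "birational X (affine_nspace d)" and y: "y \<in> X"
  shows "d \<le> vec.dim (tangent_space X y)"
proof -
  obtain B M where M: "conormal_frame X B M" "det (M y) \<noteq> 0"
    "vec.dim (tangent_space X y) = CARD('n) - card B"
    by (rule ex_conormal_frame)
  have detM: "(\<lambda>x. det (M x)) \<in> polys"
    using M(1) by (intro polys_det) (auto simp: conormal_frame_def)
  obtain U f V g x where fg: "rational_map X (affine_nspace d) U f"
    "rational_map (affine_nspace d) X V g" "x \<in> U" "f x \<in> V"
    "\<And>x. x \<in> U \<Longrightarrow> f x \<in> V \<Longrightarrow> g (f x) = x" "\<And>t. t \<in> V \<Longrightarrow> g t \<in> U \<Longrightarrow> f (g t) = t"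
    using birationalE[OF bir] by metis
  have "openin (subtopology zariski (affine_nspace d)) V"
    using fg(2) by (simp add: rational_map_def)
  from rational_map_preimage_open[OF fg(1) this fg(3,4)] obtain \<rho> where \<rho>: "\<rho> \<in> polys" "\<rho> x \<noteq> 0"
    "\<And>x. x \<in> X \<Longrightarrow> \<rho> x \<noteq> 0 \<Longrightarrow> x \<in> U \<and> f x \<in> V"
    by auto
  have "x \<in> X" using rational_map_subset[OF fg(1)] fg(3) by auto
  then obtain z where z: "z \<in> X" "\<rho> z \<noteq> 0" "det (M z) \<noteq> 0"
    using zariski_irreducibleD[OF irr \<rho>(1) detM _ \<rho>(2) y M(2)] by auto
  then have "d \<le> vec.dim (tangent_space X z)"
    using \<rho>(3)[OF z(1,2)] fg(5)
    by (intro dim_tangent_space_ge_birational_point[OF fg(1,2) _ fg(6)]) auto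
  also have "\<dots> \<le> CARD('n) - card B"
    by (rule dim_tangent_space_le[OF M(1) z(3)])
  finally show ?thesis by (simp add: M(3))
qed

section \<open>Openness of the smooth locus\<close>

lemma zariski_dim_le_dim_tangent_space:
  fixes X :: "(complex ^ 'n) set"
  assumes "rational_variety X" "x \<in> X"
  shows "zariski_dim X \<le> enat (vec.dim (tangent_space X x))"
proof -
  obtain d where X: "zariski_irreducible X" "birational X (affine_nspace d)"
    using assms(1) by (auto simp: rational_variety_def affine_variety_def)
  have "enat d \<le> enat (vec.dim (tangent_space X x))"
    using dim_tangent_space_ge[OF X assms(2)] by simp
  with zariski_dim_le_birational[OF X] show ?thesis by (rule order_trans)
qed

text \<open>Where the determinant is nonzero, the tangent dimension is at most its value at
  \<open>x\<close>, which is \<open>zariski_dim X\<close>, and it is never smaller than that.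
  Equality makes the point smooth and lets the frame span the conormal space.\<close>

lemma smooth_points_conormal_frame:
  fixes X :: "(complex ^ 'n) set"
  assumes X: "rational_variety X" and x: "x \<in> smooth_points X"
  obtains B M where "conormal_frame X B M" "det (M x) \<noteq> 0"
    "\<And>y. y \<in> X \<Longrightarrow> det (M y) \<noteq> 0 \<Longrightarrow>
      y \<in> smooth_points X \<and> conormal X y = row_combinations (M y) B"
proof -
  obtain B M where M: "conormal_frame X B M" "det (M x) \<noteq> 0"
    "vec.dim (tangent_space X x) = CARD('n) - card B"
    by (rule ex_conormal_frame)
  have dim: "zariski_dim X = enat (CARD('n) - card B)"
    using x M(3) by (simp add: smooth_points_def)
  have "y \<in> smooth_points X \<and> conormal X y = row_combinations (M y) B"
    if y: "y \<in> X" "det (M y) \<noteq> 0" for y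
  proof -
    have "CARD('n) - card B \<le> vec.dim (tangent_space X y)"
      using zariski_dim_le_dim_tangent_space[OF X y(1)] by (simp add: dim)
    then show ?thesis
      using dim_tangent_space_le[OF M(1) y(2)] conormal_eq_row_combinations[OF M(1) y(2)] y(1)
      by (simp add: smooth_points_def dim)
  qed
  with M that show ?thesis by blast
qed


section \<open>The conditional ED correspondence\<close>

lemma polys_complex_eq_poly:
  fixes p :: "complex \<Rightarrow> complex"
  assumes "p \<in> polys"
  shows "\<exists>P. p = poly P"
  using assms
proof induction
  case (const a)
  show ?case by (rule exI[of _ "[:a:]"]) auto
next
  case (coord c)
  then show ?case by (intro exI[of _ "[:0, 1:]"]) (auto simp: coords_complex_def)
next
  case (add p q)
  then obtain P Q where "p = poly P" "q = poly Q" by auto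
  then show ?case by (intro exI[of _ "P + Q"]) auto
next
  case (mult p q)
  then obtain P Q where "p = poly P" "q = poly Q" by auto
  then show ?case by (intro exI[of _ "P * Q"]) auto
qed

text \<open>The affine line is irreducible: the product of two nonzero polynomials in one variable
  is nonzero and hence has a nonroot.\<close>

lemma polys_complex_common_nonzero:
  fixes p q :: "complex \<Rightarrow> complex"
  assumes "p \<in> polys" "q \<in> polys" "p a \<noteq> 0" "q b \<noteq> 0"
  shows "\<exists>z. p z \<noteq> 0 \<and> q z \<noteq> 0"
proof -
  obtain P Q where PQ: "p = poly P" "q = poly Q"
    using assms(1,2) polys_complex_eq_poly by metis
  then have "P * Q \<noteq> 0" using assms(3,4) by auto
  then obtain z where "poly (P * Q) z \<noteq> 0" using poly_all_0_iff_0 by blast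
  then show ?thesis unfolding PQ by auto
qed

lemma polys_compose_pair:
  fixes p :: "(complex ^ 'n) \<times> (complex ^ 'm) \<Rightarrow> complex"
  assumes "p \<in> polys" "\<And>i. (\<lambda>x. a x $ i) \<in> polys" "\<And>i. (\<lambda>x. b x $ i) \<in> polys"
  shows "(\<lambda>x. p (a x, b x)) \<in> polys"
  using assms(1)
proof (rule polys_compose)
  fix c :: "(complex ^ 'n) \<times> (complex ^ 'm) \<Rightarrow> complex"
  assume "c \<in> coords"
  then show "(\<lambda>x. c (a x, b x)) \<in> polys"
    using assms(2,3) by (auto simp: coords_pair_iff)
qed

definition ED_points :: "(complex ^ 'n) set \<Rightarrow> (complex ^ 'n) set \<Rightarrow> ((complex ^ 'n) \<times> (complex ^ 'n)) set"
  where "ED_points X Z = {(x, u). x \<in> smooth_points X \<inter> Z \<and> u - x \<in> conormal X x}"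

lemma cond_ED_correspondence_eq: "cond_ED_correspondence X Z = zariski closure_of ED_points X Z"
  by (simp add: cond_ED_correspondence_def ED_points_def ED_normal_space_eq_conormal)

text \<open>
  Every point of the correspondence lies on a section \<open>x \<mapsto> (x, x + grad f x)\<close> over \<open>Z\<close>; two sections
  are joined, over a common base point, by the line through the corresponding conormal vectors.
\<close>

lemma zariski_irreducible_ED_points:
  fixes X Z :: "(complex ^ 'n) set"
  assumes X: "rational_variety X" and Z: "zariski_irreducible Z" "Z \<subseteq> X"
    and ne: "smooth_points X \<inter> Z \<noteq> {}"
  shows "zariski_irreducible (ED_points X Z)"
proof (rule zariski_irreducibleI)
  obtain x where x: "x \<in> smooth_points X" "x \<in> Z" using ne by auto
  then have "(x, x) \<in> ED_points X Z"
    by (simp add: ED_points_def vec.subspace_0[OF subspace_conormal])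
  then show "ED_points X Z \<noteq> {}" by auto
  fix p q :: "(complex ^ 'n) \<times> (complex ^ 'n) \<Rightarrow> complex" and v w
  assume pq: "p \<in> polys" "q \<in> polys"
    and v: "v \<in> ED_points X Z" "p v \<noteq> 0" and w: "w \<in> ED_points X Z" "q w \<noteq> 0"
  obtain f where f: "f \<in> vanishing_ideal X" "snd v - fst v = grad f (fst v)"
    using v(1) by (auto simp: ED_points_def conormal_def)
  obtain h where h: "h \<in> vanishing_ideal X" "snd w - fst w = grad h (fst w)"
    using w(1) by (auto simp: ED_points_def conormal_def)
  have vw: "v = (fst v, fst v + grad f (fst v))" "w = (fst w, fst w + grad h (fst w))"
    using f(2) h(2) by (simp_all add: prod_eq_iff flip: f(2) h(2))
  have gf: "(\<lambda>x. grad f x $ i) \<in> polys" and gh: "(\<lambda>x. grad h x $ i) \<in> polys" for i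
    using f(1) h(1) by (auto simp: vanishing_ideal_def intro: polys_grad)
  have fstZ: "fst v \<in> Z" "fst w \<in> Z" "fst v \<in> smooth_points X"
    using v(1) w(1) by (auto simp: ED_points_def)
  obtain B M where M: "conormal_frame X B M" "det (M (fst v)) \<noteq> 0"
    "\<And>y. y \<in> X \<Longrightarrow> det (M y) \<noteq> 0 \<Longrightarrow>
      y \<in> smooth_points X \<and> conormal X y = row_combinations (M y) B"
    using smooth_points_conormal_frame[OF X fstZ(3)] by metis
  have detM: "(\<lambda>x. det (M x)) \<in> polys"
    using M(1) by (intro polys_det) (auto simp: conormal_frame_def)
  \<comment> \<open>The determinant factor makes the common base point \<open>z\<close> found below
    a smooth point of \<open>X\<close>.\<close>
  define P where "P x = det (M x) * p (x, x + grad f x)" for x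
  define Q where "Q x = q (x, x + grad h x)" for x
  have "P \<in> polys" unfolding P_def[abs_def]
    by (intro polys.mult detM polys_compose_pair pq) (auto intro: polys.add polys_nth gf)
  moreover have "Q \<in> polys" unfolding Q_def[abs_def]
    by (intro polys_compose_pair pq) (auto intro: polys.add polys_nth gh)
  moreover have "P (fst v) \<noteq> 0" "Q (fst w) \<noteq> 0"
    using vw v(2) w(2) M(2) by (simp_all add: P_def Q_def)
  ultimately obtain z where z: "z \<in> Z" "P z \<noteq> 0" "Q z \<noteq> 0"
    using zariski_irreducibleD[OF Z(1) _ _ fstZ(1) _ fstZ(2)] by blast
  define \<psi> where "\<psi> s = (z, z + ((1 - s) *s grad f z + s *s grad h z))" for s
  have "(\<lambda>s. r (\<psi> s)) \<in> polys" if "r \<in> polys" for r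
    unfolding \<psi>_def using that
    by (rule polys_compose_pair)
      (auto intro!: polys.const polys.add polys.mult polys_ident polys_diff)
  moreover have "p (\<psi> 0) \<noteq> 0" "q (\<psi> 1) \<noteq> 0"
    using z by (simp_all add: \<psi>_def P_def Q_def)
  ultimately obtain s where s: "p (\<psi> s) \<noteq> 0" "q (\<psi> s) \<noteq> 0"
    using polys_complex_common_nonzero[of "\<lambda>s. p (\<psi> s)" "\<lambda>s. q (\<psi> s)" 0 1] pq by blast
  have "grad f z \<in> conormal X z" "grad h z \<in> conormal X z"
    using f(1) h(1) by (auto simp: conormal_def)
  then have "(1 - s) *s grad f z + s *s grad h z \<in> conormal X z"
    by (rule conormal_linear_combination)
  moreover have "z \<in> smooth_points X"
    using M(3)[of z] z Z(2) by (auto simp: P_def)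
  ultimately have "\<psi> s \<in> ED_points X Z"
    using z(1) by (simp add: \<psi>_def ED_points_def)
  with s show "\<exists>e\<in>ED_points X Z. p e \<noteq> 0 \<and> q e \<noteq> 0" by blast
qed

text \<open>By Cramer's rule, \<open>frame_coordinate M k (x, u) / det (M x)\<close> is the coefficient of row \<open>k\<close> in \<open>u - x\<close>.\<close>

definition frame_coordinate ::
    "(complex ^ 'n \<Rightarrow> complex ^ 'n ^ 'n) \<Rightarrow> 'n \<Rightarrow> (complex ^ 'n) \<times> (complex ^ 'n) \<Rightarrow> complex" where
  "frame_coordinate M k p =
     det (\<chi> i j. if j = k then (snd p - fst p) $ i else M (fst p) $ j $ i)"

section \<open>Cramer coordinates and the birational trivialization\<close>

lemma polys_frame_coordinate:
  assumes "\<And>i j. (\<lambda>x. M x $ i $ j) \<in> polys"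
  shows "frame_coordinate M k \<in> polys"
proof -
  have *: "(\<lambda>p. if j = k then (snd p - fst p) $ i else M (fst p) $ j $ i) \<in> polys" for i j
    using polys_diff[OF polys_snd[OF polys_nth] polys_fst[OF polys_nth], of i i]
      polys_fst[OF assms, of j i]
    by (cases "j = k") simp_all
  show ?thesis
    unfolding frame_coordinate_def[abs_def] by (rule polys_det) (simp only: vec_lambda_beta *)
qed

text \<open>Combining rows means solving a system with the transposed matrix; hence the swapped
  indices in \<open>frame_coordinate\<close>.\<close>

lemma frame_coordinate_iff:
  assumes "det (M x) \<noteq> 0"
  shows "u - x = c v* M x \<longleftrightarrow> c = (\<chi> k. frame_coordinate M k (x, u) / det (M x))"
proof -
  have "u - x = c v* M x \<longleftrightarrow> transpose (M x) *v c = u - x"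
    by (auto simp: eq_commute)
  also have "\<dots> \<longleftrightarrow> c = (\<chi> k. frame_coordinate M k (x, u) / det (M x))"
    using assms unfolding cramer[of "transpose (M x)", unfolded det_transpose, OF assms]
    by (simp add: frame_coordinate_def transpose_def cong: if_cong)
  finally show ?thesis .
qed

text \<open>Over an open part of \<open>Z\<close>, a point \<open>(x, u)\<close> is encoded by the
  \<open>e\<close> parameters of \<open>x\<close> followed by the \<open>card B\<close> frame
  coordinates of \<open>u - x\<close>. The inverse map rebuilds \<open>x\<close> by \<open>g\<close>
  and adds the combination of frame rows.\<close>

lemma birational_cond_ED_correspondence:
  fixes X Z :: "(complex ^ 'n) set"
  assumes X: "rational_variety X" and Z: "rational_variety Z" and ZX: "Z \<subseteq> X"
    and ne: "smooth_points X \<inter> Z \<noteq> {}"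
  shows "\<exists>d. birational (cond_ED_correspondence X Z) (affine_nspace d)"
proof -
  define E where "E = cond_ED_correspondence X Z"
  have E_closure: "E = zariski closure_of ED_points X Z"
    by (simp add: E_def cond_ED_correspondence_eq)
  have ED_sub: "ED_points X Z \<subseteq> E"
    unfolding E_closure by (rule closure_of_subset) simp
  obtain x\<^sub>0 where x0: "x\<^sub>0 \<in> smooth_points X" "x\<^sub>0 \<in> Z" using ne by auto
  obtain B M where M: "conormal_frame X B M" "det (M x\<^sub>0) \<noteq> 0"
    "\<And>y. y \<in> X \<Longrightarrow> det (M y) \<noteq> 0 \<Longrightarrow>
      y \<in> smooth_points X \<and> conormal X y = row_combinations (M y) B"
    using smooth_points_conormal_frame[OF X x0(1)] by metis
  have Mpoly: "(\<lambda>x. M x $ i $ j) \<in> polys" for i j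
    using M(1) by (simp add: conormal_frame_def)
  have detM: "(\<lambda>x. det (M x)) \<in> polys"
    by (rule polys_det) (rule Mpoly)
  have irrZ: "zariski_irreducible Z" and closedZ: "closedin zariski Z"
    using Z by (simp_all add: rational_variety_def affine_variety_def)
  obtain e where bir: "birational Z (affine_nspace e)"
    using Z by (auto simp: rational_variety_def)
  obtain U f V g x\<^sub>1 where fg: "rational_map Z (affine_nspace e) U f"
    "rational_map (affine_nspace e) Z V g" "x\<^sub>1 \<in> U" "f x\<^sub>1 \<in> V"
    "\<And>x. x \<in> U \<Longrightarrow> f x \<in> V \<Longrightarrow> g (f x) = x" "\<And>t. t \<in> V \<Longrightarrow> g t \<in> U \<Longrightarrow> f (g t) = t"
    using birationalE[OF bir] by metis
  have "openin (subtopology zariski (affine_nspace e)) V"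
    using fg(2) by (simp add: rational_map_def)
  from rational_map_preimage_open[OF fg(1) this fg(3,4)] obtain \<rho> where \<rho>: "\<rho> \<in> polys" "\<rho> x\<^sub>1 \<noteq> 0"
    "\<And>x. x \<in> Z \<Longrightarrow> \<rho> x \<noteq> 0 \<Longrightarrow> x \<in> U \<and> f x \<in> V"
    by auto
  have "x\<^sub>1 \<in> Z" using rational_map_subset[OF fg(1)] fg(3) by auto
  \<comment> \<open>Irreducibility of \<open>Z\<close> makes the locus of the parametrization meet
    the locus where the frame is independent.\<close>
  then obtain x\<^sub>2 where x2: "x\<^sub>2 \<in> Z" "\<rho> x\<^sub>2 \<noteq> 0" "det (M x\<^sub>2) \<noteq> 0"
    using zariski_irreducibleD[OF irrZ \<rho>(1) detM _ \<rho>(2) x0(2) M(2)] by auto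
  define \<delta> where "\<delta> x = \<rho> x * det (M x)" for x
  have \<delta>: "\<delta> \<in> polys" unfolding \<delta>_def[abs_def] by (intro polys.mult \<rho>(1) detM)
  have \<delta>D: "x \<in> U" "f x \<in> V" "det (M x) \<noteq> 0" "g (f x) = x" if "x \<in> Z" "\<delta> x \<noteq> 0" for x
    using \<rho>(3)[of x] that fg(5) by (auto simp: \<delta>_def)
  have x2': "\<delta> x\<^sub>2 \<noteq> 0" using x2 by (simp add: \<delta>_def)
  have opn: "openin (subtopology zariski Z) ({x. \<delta> x \<noteq> 0} \<inter> Z)"
    unfolding openin_subtopology using openin_poly_nonzero[OF \<delta>] by blast
  have "g (f x\<^sub>2) \<in> {x. \<delta> x \<noteq> 0} \<inter> Z"
    using x2(1) x2' \<delta>D(4) by simp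
  \<comment> \<open>\<omega> cuts out, on the parameter side, points that \<open>g\<close> sends
    into the good open part of \<open>Z\<close>.\<close>
  from rational_map_preimage_open[OF fg(2) opn, OF \<delta>D(2)[OF x2(1) x2'] this]
  obtain \<omega> where \<omega>: "\<omega> \<in> polys" "\<omega> (f x\<^sub>2) \<noteq> 0"
    "\<And>t. t \<in> affine_nspace e \<Longrightarrow> \<omega> t \<noteq> 0 \<Longrightarrow> t \<in> V \<and> g t \<in> Z \<and> \<delta> (g t) \<noteq> 0"
    by auto
  define r where "r = card B"
  \<comment> \<open>\<open>B\<close> is numbered from 0 so that its coordinates can occupy the
    positions from \<open>e\<close> to \<open>e + r - 1\<close>.\<close>
  obtain h where h: "bij_betw h {..<r} B"
    using ex_bij_betw_nat_finite[of B] by (auto simp: r_def atLeast0LessThan)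
  define h' where "h' = inv_into {..<r} h"
  have hh': "h' k < r" "h (h' k) = k" if "k \<in> B" for k
    using h that by (auto simp: h'_def bij_betw_def f_inv_into_f intro: inv_into_into[of k h "{..<r}", simplified])
  have h'h: "h j \<in> B" "h' (h j) = j" if "j < r" for j
    using h that by (auto simp: h'_def bij_betw_def inv_into_f_f)
  have E_Z: "fst p \<in> Z" if "p \<in> E" for p
  proof -
    obtain F where F: "F \<subseteq> polys" "Z = zeros F" using closedZ by (auto simp: closedin_zariski)
    have "q (fst p) = 0" if "q \<in> F" for q
    proof (rule zariski_closure_of_vanish[of "\<lambda>p. q (fst p)" "ED_points X Z"])
      show "(\<lambda>p. q (fst p)) \<in> polys" using polys_fst[of q] that F(1) by blast
      show "p \<in> zariski closure_of ED_points X Z" using \<open>p \<in> E\<close> by (simp add: E_closure)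
    qed (use that F in \<open>auto simp: ED_points_def zeros_def\<close>)
    then show ?thesis by (simp add: F(2) zeros_def)
  qed
  define c where "c p = (\<chi> k. frame_coordinate M k p / det (M (fst p)))" for p
  have fc: "frame_coordinate M k \<in> polys" for k
    by (rule polys_frame_coordinate) (rule Mpoly)
  have c_iff: "u - x = b v* M x \<longleftrightarrow> b = c (x, u)" if "det (M x) \<noteq> 0" for x u b
    using frame_coordinate_iff[of M x, OF that] by (simp add: c_def)
  have c_out: "c p $ k = 0" if p: "p \<in> E" "det (M (fst p)) \<noteq> 0" and k: "k \<notin> B" for p k
  proof -
    \<comment> \<open>Points of \<open>E\<close> need not lie in \<open>ED_points\<close>, so the
      claim has to come from a polynomial equation on all of \<open>ED_points\<close>. The
      determinant factor keeps it true where the frame degenerates.\<close>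
    have "det (M (fst p)) * frame_coordinate M k p = 0"
    proof (rule zariski_closure_of_vanish[of "\<lambda>p. det (M (fst p)) * frame_coordinate M k p"])
      show "(\<lambda>p. det (M (fst p)) * frame_coordinate M k p) \<in> polys"
        by (intro polys.mult fc polys_fst[OF detM])
      show "p \<in> zariski closure_of ED_points X Z" using p(1) by (simp add: E_closure)
      fix y assume "y \<in> ED_points X Z"
      then obtain x u where y: "y = (x, u)" "x \<in> Z" "u - x \<in> conormal X x"
        by (auto simp: ED_points_def)
      show "det (M (fst y)) * frame_coordinate M k y = 0"
      proof (cases "det (M x) = 0")
        case False
        then have "u - x \<in> row_combinations (M x) B" using M(3)[of x] y ZX by auto
        then obtain b where b: "u - x = b v* M x" "b $ k = 0"
          using k by (auto simp: row_combinations_def)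
        then have "c y $ k = 0" using c_iff[OF False] y(1) by simp
        then show ?thesis by (auto simp: c_def)
      qed (simp add: y(1))
    qed
    then show ?thesis using p(2) by (simp add: c_def)
  qed
  have E_section: "(x, x + b v* M x) \<in> E" if "x \<in> Z" "det (M x) \<noteq> 0" "\<And>k. k \<notin> B \<Longrightarrow> b $ k = 0" for x b
  proof -
    have "b v* M x \<in> conormal X x" "x \<in> smooth_points X"
      using M(3)[of x] that ZX by (auto simp: row_combinations_def)
    then have "(x, x + b v* M x) \<in> ED_points X Z"
      using that(1) by (simp add: ED_points_def)
    then show ?thesis using ED_sub by auto
  qed
  define d where "d = e + r"
  \<comment> \<open>A parameter sequence is split: \<open>tr\<close> is padded with zeros to lie in
    affine \<open>e\<close>-space, and \<open>tl\<close> spreads the next \<open>r\<close> entries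
    over \<open>B\<close>.\<close>
  define tr where "tr \<tau> = (\<lambda>i. if i < e then \<tau> i else 0)" for \<tau> :: "nat \<Rightarrow> complex"
  define tl where "tl \<tau> = (\<chi> k. if k \<in> B then \<tau> (e + h' k) else 0)" for \<tau> :: "nat \<Rightarrow> complex"
  define \<Phi> where "\<Phi> p = (\<lambda>j. if j < e then f (fst p) j else if j < d then c p $ h (j - e) else 0)" for p
  define \<Psi> where "\<Psi> \<tau> = (g (tr \<tau>), g (tr \<tau>) + tl \<tau> v* M (g (tr \<tau>)))" for \<tau>
  define U' where "U' = {p \<in> E. \<delta> (fst p) \<noteq> 0}"
  define V' where "V' = {\<tau> \<in> affine_nspace d. \<omega> (tr \<tau>) \<noteq> 0}"
  have tr_in: "tr \<tau> \<in> affine_nspace e" for \<tau> by (simp add: tr_def affine_nspace_def)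
  have tr_poly: "(\<lambda>\<tau>. a (tr \<tau>)) \<in> polys" if "a \<in> coords" for a
  proof -
    obtain i where "a = (\<lambda>t. t i)" using \<open>a \<in> coords\<close> by (auto simp: coords_seq_iff)
    then show ?thesis by (cases "i < e") (auto simp: tr_def intro: polys_apply polys.const)
  qed
  have tl_poly: "(\<lambda>\<tau>. tl \<tau> $ k) \<in> polys" for k
    by (cases "k \<in> B") (auto simp: tl_def intro: polys_apply polys.const)
  have \<omega>_tr: "(\<lambda>\<tau>. \<omega> (tr \<tau>)) \<in> polys"
    using \<omega>(1) tr_poly by (rule polys_compose)
  have V'D: "tr \<tau> \<in> V" "g (tr \<tau>) \<in> Z" "\<delta> (g (tr \<tau>)) \<noteq> 0" if "\<tau> \<in> V'" for \<tau>
    using \<omega>(3)[OF tr_in, of \<tau>] that by (auto simp: V'_def)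
  have tl_out: "tl \<tau> $ k = 0" if "k \<notin> B" for \<tau> k using that by (simp add: tl_def)
  have \<Psi>_E: "\<Psi> \<tau> \<in> E" if "\<tau> \<in> V'" for \<tau>
    unfolding \<Psi>_def using V'D[OF that] \<delta>D(3) tl_out by (intro E_section) auto
  have U'D: "fst p \<in> Z" "\<delta> (fst p) \<noteq> 0" "p \<in> E" if "p \<in> U'" for p
    using that E_Z by (auto simp: U'_def)
  have tr_\<Phi>: "tr (\<Phi> p) = f (fst p)" if "p \<in> U'" for p
    using rational_map_in[OF fg(1) \<delta>D(1)[OF U'D(1,2)[OF that]]]
    by (auto simp: tr_def \<Phi>_def affine_nspace_def)
  have tl_\<Phi>: "tl (\<Phi> p) = c p" if "p \<in> U'" for p
    using c_out[OF U'D(3)[OF that] \<delta>D(3)[OF U'D(1,2)[OF that]]] hh'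
    by (auto simp: vec_eq_iff tl_def \<Phi>_def d_def)
  have \<Psi>\<Phi>: "\<Psi> (\<Phi> p) = p" if "p \<in> U'" for p
  proof -
    note D = \<delta>D[OF U'D(1,2)[OF that]]
    have "snd p - fst p = c p v* M (fst p)"
      using c_iff[OF D(3), of "snd p" "c p"] by simp
    then have "fst p + c p v* M (fst p) = snd p" by (simp flip: \<open>snd p - fst p = _\<close>)
    then show ?thesis
      by (simp add: \<Psi>_def tr_\<Phi>[OF that] tl_\<Phi>[OF that] D(4))
  qed
  have \<Phi>\<Psi>: "\<Phi> (\<Psi> \<tau>) = \<tau>" if "\<tau> \<in> V'" for \<tau>
  proof
    fix j
    note D = V'D[OF that]
    have "f (g (tr \<tau>)) = tr \<tau>" using fg(6)[OF D(1)] \<delta>D(1)[OF D(2,3)] by simp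
    moreover have "c (\<Psi> \<tau>) = tl \<tau>"
      using c_iff[OF \<delta>D(3)[OF D(2,3)], of "snd (\<Psi> \<tau>)" "tl \<tau>"] by (simp add: \<Psi>_def)
    moreover have "\<tau> j = 0" if "d \<le> j" using \<open>\<tau> \<in> V'\<close> that by (simp add: V'_def affine_nspace_def)
    ultimately show "\<Phi> (\<Psi> \<tau>) j = \<tau> j"
      using h'h[of "j - e"] by (auto simp: \<Phi>_def tr_def tl_def d_def \<Psi>_def)
  qed
  \<comment> \<open>The zero conormal vector over \<open>x\<^sub>2\<close> gives a point in the
    domain; with its image it shows that both maps and both composites have nonempty
    domains.\<close>
  have x2U: "(x\<^sub>2, x\<^sub>2) \<in> U'"
    using E_section[of x\<^sub>2 0] x2 x2' by (simp add: U'_def)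
  have \<Phi>_in: "\<Phi> p \<in> affine_nspace d" for p
    by (simp add: \<Phi>_def affine_nspace_def d_def)
  have x2V: "\<Phi> (x\<^sub>2, x\<^sub>2) \<in> V'"
    using tr_\<Phi>[OF x2U] \<omega>(2) \<Phi>_in by (simp add: V'_def)
  have map1: "rational_map E (affine_nspace d) U' \<Phi>"
    unfolding rational_map_def
  proof (intro conjI ballI)
    have "U' = {p. \<delta> (fst p) \<noteq> 0} \<inter> E" by (auto simp: U'_def)
    then show "openin (subtopology zariski E) U'"
      unfolding openin_subtopology using openin_poly_nonzero[OF polys_fst[OF \<delta>]] by blast
    show "U' \<noteq> {}" using x2U by auto
    show "\<Phi> ` U' \<subseteq> affine_nspace d" using \<Phi>_in by auto
    fix a :: "(nat \<Rightarrow> complex) \<Rightarrow> complex" assume "a \<in> coords"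
    then obtain j where a: "a = (\<lambda>t. t j)" by (auto simp: coords_seq_iff)
    have "regular_function U' (\<lambda>p. f (fst p) j)"
    proof (rule regular_function_compose_poly[of U "\<lambda>x. f x j"])
      show "regular_function U (\<lambda>x. f x j)"
        by (rule rational_map_regular[OF fg(1) polys_apply])
      show "fst p \<in> U" if "p \<in> U'" for p using \<delta>D(1) U'D[OF that] by auto
    qed (auto intro: polys_fst polys.coord)
    moreover have "regular_function U' (\<lambda>p. c p $ k)" for k
      unfolding c_def using U'D \<delta>D(3)
      by (auto intro!: regular_function_divide fc polys_fst[OF detM])
    ultimately show "regular_function U' (\<lambda>p. a (\<Phi> p))"
      unfolding a \<Phi>_def
      by (cases "j < e"; cases "j < d") (auto intro: regular_function_poly polys.const)
  qed
  have reg_tr: "regular_function V' (\<lambda>\<tau>. p (g (tr \<tau>)))" if "p \<in> polys" for p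
    using rational_map_regular[OF fg(2) that] V'D(1) tr_poly
    by (rule regular_function_compose_poly)
  have map2: "rational_map (affine_nspace d) E V' \<Psi>"
    unfolding rational_map_def
  proof (intro conjI ballI)
    have "V' = {\<tau>. \<omega> (tr \<tau>) \<noteq> 0} \<inter> affine_nspace d" by (auto simp: V'_def)
    then show "openin (subtopology zariski (affine_nspace d)) V'"
      unfolding openin_subtopology using openin_poly_nonzero[OF \<omega>_tr] by blast
    show "V' \<noteq> {}" using x2V by auto
    show "\<Psi> ` V' \<subseteq> E" using \<Psi>_E by auto
    fix a :: "(complex ^ 'n) \<times> (complex ^ 'n) \<Rightarrow> complex" assume a: "a \<in> coords"
    have "regular_function V'
        (\<lambda>\<tau>. g (tr \<tau>) $ i + (\<Sum>k\<in>UNIV. tl \<tau> $ k * M (g (tr \<tau>)) $ k $ i))" for i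
      by (intro regular_function_add regular_function_sum regular_function_mult reg_tr[OF Mpoly]
          reg_tr[OF polys_nth] regular_function_poly[OF tl_poly])
    then show "regular_function V' (\<lambda>\<tau>. a (\<Psi> \<tau>))"
      using a reg_tr[OF polys_nth] by (auto simp: coords_pair_iff \<Psi>_def vector_matrix_mult_def)
  qed
  have "birational E (affine_nspace d)"
    unfolding birational_def
  proof (intro exI conjI)
    show "U' \<inter> \<Phi> -` V' \<noteq> {}" using x2U x2V by auto
    show "V' \<inter> \<Psi> -` U' \<noteq> {}" using x2U x2V \<Psi>\<Phi>[OF x2U] by auto
  qed (use map1 map2 \<Psi>\<Phi> \<Phi>\<Psi> in auto)
  then show ?thesis unfolding E_def by blast
qed

text \<open>If \<open>Z\<close> contained no smooth point of \<open>X\<close>, the correspondence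
  would be empty and so not irreducible; the last hypothesis excludes this.\<close>

theorem proposition5p14:
  fixes X Z :: "(complex ^ 'n) set"
  assumes "rational_variety X"
    and "rational_variety Z"
    and "Z \<subseteq> X"
    and "smooth_points X \<inter> Z \<noteq> {}"
  shows "rational_variety (cond_ED_correspondence X Z)"
proof -
  have "zariski_irreducible Z"
    using assms(2) by (simp add: rational_variety_def affine_variety_def)
  then have "affine_variety (cond_ED_correspondence X Z)"
    unfolding affine_variety_def cond_ED_correspondence_eq
    using zariski_irreducible_ED_points[OF assms(1) _ assms(3,4)]
    by (simp add: zariski_irreducible_closure_of)
  then show ?thesis
    using birational_cond_ED_correspondence[OF assms] by (simp add: rational_variety_def)
qed

end
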